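(* Let there exist $0<\delta\le1$, $\rho>1$ and a constant $C$ such that $\mathbb{E}(|Y_1|^{2+\delta})<\infty$ and $\alpha_Y(k)\le Ck^{-\rho(2+\delta)(1+\delta)/\delta^2}$ for all $k\in\mathbb{N}$. Moreover, let either $\rho>\frac{\delta(8+\delta)}{(2+\delta)(1+\delta)}$ or $\mathbb{E}(|Y_1|^{4+2\delta})<\infty$. Then, under the hypothesis that $\mu$ is constant (there is $\mu_H\in\mathbb{R}$ with $\mu(x)=\mu_H$ for almost all $x\in[0,1]$), $$|\hat\psi_n^2-\psi^2|\longrightarrow0\quad\text{in }L^1\text{ as }n\to\infty .$$
   Context: $(Y_i)_{i\in\mathbb{N}}$ is a strictly stationary real-valued process with $\mathbb{E}(Y_1)=0$, $\mathrm{Var}(Y_1)=1$. For $\sigma$-fields $\mathcal{A},\mathcal{B}$ let $\alpha(\mathcal{A},\mathcal{B})=\sup\{|\mathbb{P}(A)\mathbb{P}(B)-\mathbb{P}(A\cap B)|:A\in\mathcal{A},B\in\mathcal{B}\}$ and $\alpha_Y(k)=\sup_{m\in\mathbb{N}}\alpha(\sigma(Y_1,\dots,Y_m),\sigma(Y_{k+m},Y_{k+m+1},\dots))$; $(Y_i)$ is $\alpha$-mixing, i.e. $\alpha_Y(k)\to0$. The long run variance $\kappa_Y^2=\mathrm{Var}(Y_1)+2\sum_{k=1}^\infty\mathrm{Cov}(Y_1,Y_{k+1})$ (finite under the moment and mixing assumptions made) satisfies $\kappa_Y^2>0$. Observations: $X_i=X_{i,n}=\mu(i/n)+\sigma(i/n)Y_i$,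 $i=1,\dots,n$, where $\mu:[0,1]\to\mathbb{R}$ is càdlàg and $\sigma:[0,1]\to(0,\infty)$ is càdlàg and piecewise Lipschitz-continuous (the sum of a Lipschitz-continuous function and a piecewise constant function with a fixed finite number of jumps), with $\sigma(x)\ge\sigma_0$ for all $x\in[0,1]$ and some $\sigma_0>0$. Blocks: $\ell_n=n^s$, $b_n=n^{1-s}$ with $s\in(0.5,1)$, both assumed to be integers; local means $\hat\mu_j=\frac1{\ell_n}\sum_{i=(j-1)\ell_n+1}^{j\ell_n}X_i$ and local variances $\hat\sigma_{j,n}^2=\frac1{\ell_n}\sum_{i=(j-1)\ell_n+1}^{j\ell_n}(X_i-\hat\mu_j)^2$, $1\le j\le b_n$. For independent standard normal $Z,Z'$ define $f_n:\mathbb{R}_{\ge0}^{b_n}\to\mathbb{R}_{\ge0}$ by $$f_n(x_1,\dots,x_{b_n})=\frac1{b_n}\sum_{j=1}^{b_n}\mathbb{E}\left(\left|\frac1{b_n-1}\sum_{1\le k\le b_n,\,k\ne j}\Big(\mathbb{E}\big(|x_jZ-x_kZ'|\,\big|\,Z\big)-\mathbb{E}\big(|x_jZ-x_kZ'|\big)\Big)\right|^2\right),$$ $\hat\psi_n^2:=4f_n(\hat\sigma_{1,n},\dots,\hat\sigma_{b_n,n})$ (the deterministic function $f_n$ evaluated at the random point), and $$\psi^2=4\int_0^1\mathbb{E}\left(\left|\int_0^1\Big(\mathbb{E}\big(|\sigma(x)Z-\sigma(y)Z'|\,\big|\,Z\big)-\mathbb{E}\big(|\sigma(x)Z-\sigma(y)Z'|\big)\Big)\mathrm{d}y\right|^2\right)\mathrm{d}x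 .$$ *)

theory Defs
  imports "HOL-Probability.Probability"
begin

section \<open>Stationary alpha-mixing processes\<close>

text \<open>Processes are indexed by the positive integers; the value at index 0 of a function
  on \<^typ>\<open>nat\<close> plays no role.\<close>

definition strictly_stationary :: "'a measure \<Rightarrow> (nat \<Rightarrow> 'a \<Rightarrow> real) \<Rightarrow> bool" where
  "strictly_stationary M Y \<longleftrightarrow>
     (\<forall>h. distr M (\<Pi>\<^sub>M i\<in>{1..}. borel) (\<lambda>\<omega>. \<lambda>i\<in>{1..}. Y (i + h) \<omega>) =
          distr M (\<Pi>\<^sub>M i\<in>{1..}. borel) (\<lambda>\<omega>. \<lambda>i\<in>{1..}. Y i \<omega>))"

definition sigma_field_of :: "'a measure \<Rightarrow> (nat \<Rightarrow> 'a \<Rightarrow> real) \<Rightarrow> nat set \<Rightarrow> 'a set set" where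
  "sigma_field_of M Y I =
     sigma_sets (space M) (\<Union>i\<in>I. {Y i -` S \<inter> space M | S. S \<in> sets borel})"

definition alpha_coeff :: "'a measure \<Rightarrow> 'a set set \<Rightarrow> 'a set set \<Rightarrow> real" where
  "alpha_coeff M \<A> \<B> =
     Sup {\<bar>measure M A * measure M B - measure M (A \<inter> B)\<bar> | A B. A \<in> \<A> \<and> B \<in> \<B>}"

definition alpha_mixing_coeff :: "'a measure \<Rightarrow> (nat \<Rightarrow> 'a \<Rightarrow> real) \<Rightarrow> nat \<Rightarrow> real" where
  "alpha_mixing_coeff M Y k =
     (SUP m\<in>{1..}. alpha_coeff M (sigma_field_of M Y {1..m}) (sigma_field_of M Y {k + m..}))"

definition alpha_mixing :: "'a measure \<Rightarrow> (nat \<Rightarrow> 'a \<Rightarrow> real) \<Rightarrow> bool" where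
  "alpha_mixing M Y \<longleftrightarrow> alpha_mixing_coeff M Y \<longlonglongrightarrow> 0"

definition covariance :: "'a measure \<Rightarrow> ('a \<Rightarrow> real) \<Rightarrow> ('a \<Rightarrow> real) \<Rightarrow> real" where
  "covariance M U V =
     (\<integral>\<omega>. (U \<omega> - (\<integral>\<omega>'. U \<omega>' \<partial>M)) * (V \<omega> - (\<integral>\<omega>'. V \<omega>' \<partial>M)) \<partial>M)"

text \<open>The lag \<open>k = 1, 2, \<dots>\<close> of the usual series is \<open>Suc k\<close> here.\<close>

definition long_run_variance :: "'a measure \<Rightarrow> (nat \<Rightarrow> 'a \<Rightarrow> real) \<Rightarrow> real" where
  "long_run_variance M Y =
     covariance M (Y 1) (Y 1) + 2 * (\<Sum>k. covariance M (Y 1) (Y (Suc k + 1)))"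


section \<open>Mean and scale functions on the unit interval\<close>

text \<open>Functions on \<open>[0,1]\<close> are represented by total functions whose values outside
  \<open>[0,1]\<close> are never used.\<close>

definition cadlag01 :: "(real \<Rightarrow> real) \<Rightarrow> bool" where
  "cadlag01 f \<longleftrightarrow>
     (\<forall>x\<in>{0..<1}. (f \<longlongrightarrow> f x) (at_right x)) \<and>
     (\<forall>x\<in>{0<..1}. \<exists>l. (f \<longlongrightarrow> l) (at_left x))"

text \<open>\<open>J\<close> is the finite set of possible jump points; the values at the points of \<open>J\<close>
  are unrestricted.\<close>

definition piecewise_constant01 :: "(real \<Rightarrow> real) \<Rightarrow> bool" where
  "piecewise_constant01 h \<longleftrightarrow>
     (\<exists>J. finite J \<and> (\<forall>x\<in>{0..1}. \<forall>y\<in>{0..1}. x \<le> y \<and> {x..y} \<inter> J = {} \<longrightarrow> h x = h y))"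

definition piecewise_lipschitz01 :: "(real \<Rightarrow> real) \<Rightarrow> bool" where
  "piecewise_lipschitz01 f \<longleftrightarrow>
     (\<exists>g h L. L-lipschitz_on {0..1} g \<and> piecewise_constant01 h \<and> (\<forall>x\<in>{0..1}. f x = g x + h x))"


section \<open>Observations, blocks and local statistics\<close>

definition obs ::
  "(real \<Rightarrow> real) \<Rightarrow> (real \<Rightarrow> real) \<Rightarrow> (nat \<Rightarrow> 'a \<Rightarrow> real) \<Rightarrow> nat \<Rightarrow> nat \<Rightarrow> 'a \<Rightarrow> real" where
  "obs \<mu> \<sigma> Y n i \<omega> = \<mu> (real i / real n) + \<sigma> (real i / real n) * Y i \<omega>"

text \<open>The sample sizes for which both block parameters \<open>n\<^sup>s\<close> and \<open>n\<^sup>1\<^sup>-\<^sup>s\<close> are integers.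
  Asymptotic statements are along this set; on it the floors below are exact.\<close>

definition admissible :: "real \<Rightarrow> nat set" where
  "admissible s = {n. 1 \<le> n \<and> real n powr s \<in> \<nat> \<and> real n powr (1 - s) \<in> \<nat>}"

definition block_length :: "real \<Rightarrow> nat \<Rightarrow> nat" where
  "block_length s n = nat \<lfloor>real n powr s\<rfloor>"

definition num_blocks :: "real \<Rightarrow> nat \<Rightarrow> nat" where
  "num_blocks s n = nat \<lfloor>real n powr (1 - s)\<rfloor>"

definition local_mean :: "nat \<Rightarrow> (nat \<Rightarrow> 'a \<Rightarrow> real) \<Rightarrow> nat \<Rightarrow> 'a \<Rightarrow> real" where
  "local_mean l X j \<omega> = (1 / real l) * (\<Sum>i = (j - 1) * l + 1..j * l. X i \<omega>)"

definition local_var :: "nat \<Rightarrow> (nat \<Rightarrow> 'a \<Rightarrow> real) \<Rightarrow> nat \<Rightarrow> 'a \<Rightarrow> real" where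
  "local_var l X j \<omega> =
     (1 / real l) * (\<Sum>i = (j - 1) * l + 1..j * l. (X i \<omega> - local_mean l X j \<omega>)\<^sup>2)"

definition local_sd :: "nat \<Rightarrow> (nat \<Rightarrow> 'a \<Rightarrow> real) \<Rightarrow> nat \<Rightarrow> 'a \<Rightarrow> real" where
  "local_sd l X j \<omega> = sqrt (local_var l X j \<omega>)"


section \<open>The asymptotic variance and its estimator\<close>

text \<open>\<open>Z\<close> and \<open>Z'\<close> live on a probability space \<open>P\<close> of their own;
  conditioning on \<open>Z\<close> means conditioning on the generated sigma-field.\<close>

definition cond_exp_given ::
  "'b measure \<Rightarrow> ('b \<Rightarrow> real) \<Rightarrow> ('b \<Rightarrow> real) \<Rightarrow> 'b \<Rightarrow> real" where
  "cond_exp_given P Z U = real_cond_exp P (vimage_algebra (space P) Z borel) U"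

definition f_fun ::
  "'b measure \<Rightarrow> ('b \<Rightarrow> real) \<Rightarrow> ('b \<Rightarrow> real) \<Rightarrow> nat \<Rightarrow> (nat \<Rightarrow> real) \<Rightarrow> real" where
  "f_fun P Z Z' b x =
     (1 / real b) * (\<Sum>j = 1..b. \<integral>\<omega>.
        \<bar>(1 / (real b - 1)) * (\<Sum>k\<in>{1..b} - {j}.
            cond_exp_given P Z (\<lambda>\<omega>'. \<bar>x j * Z \<omega>' - x k * Z' \<omega>'\<bar>) \<omega>
            - (\<integral>\<omega>'. \<bar>x j * Z \<omega>' - x k * Z' \<omega>'\<bar> \<partial>P))\<bar>\<^sup>2 \<partial>P)"

definition psi_hat_sq ::
  "'b measure \<Rightarrow> ('b \<Rightarrow> real) \<Rightarrow> ('b \<Rightarrow> real) \<Rightarrow> real \<Rightarrow>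
   (real \<Rightarrow> real) \<Rightarrow> (real \<Rightarrow> real) \<Rightarrow> (nat \<Rightarrow> 'a \<Rightarrow> real) \<Rightarrow> nat \<Rightarrow> 'a \<Rightarrow> real" where
  "psi_hat_sq P Z Z' s \<mu> \<sigma> Y n \<omega> =
     4 * f_fun P Z Z' (num_blocks s n)
           (\<lambda>j. local_sd (block_length s n) (obs \<mu> \<sigma> Y n) j \<omega>)"

text \<open>A conditional expectation given \<open>Z\<close> is determined only up to a null set, for each
  pair \<open>(x, y)\<close> separately. Integrating it over \<open>y\<close> for fixed \<open>\<omega>\<close>, as in
  \<open>psi_sq\<close>, requires versions that are jointly measurable in \<open>(x, y, \<omega>)\<close>. Such versions
  exist (lemma \<open>cond_abs_version_exists\<close> below), and by Fubini's theorem the value of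
  \<open>psi_sq\<close> does not depend on the choice.\<close>

definition cond_abs_version ::
  "'b measure \<Rightarrow> ('b \<Rightarrow> real) \<Rightarrow> ('b \<Rightarrow> real) \<Rightarrow> (real \<Rightarrow> real \<Rightarrow> 'b \<Rightarrow> real) \<Rightarrow> bool" where
  "cond_abs_version P Z Z' G \<longleftrightarrow>
     (\<lambda>(x, y, \<omega>). G x y \<omega>) \<in>
        borel_measurable (borel \<Otimes>\<^sub>M borel \<Otimes>\<^sub>M vimage_algebra (space P) Z borel) \<and>
     (\<forall>x y. AE \<omega> in P. G x y \<omega> = cond_exp_given P Z (\<lambda>\<omega>'. \<bar>x * Z \<omega>' - y * Z' \<omega>'\<bar>) \<omega>)"

definition psi_sq ::
  "'b measure \<Rightarrow> ('b \<Rightarrow> real) \<Rightarrow> ('b \<Rightarrow> real) \<Rightarrow> (real \<Rightarrow> real \<Rightarrow> 'b \<Rightarrow> real) \<Rightarrow>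
   (real \<Rightarrow> real) \<Rightarrow> real" where
  "psi_sq P Z Z' G \<sigma> =
     4 * (LBINT x:{0..1}. \<integral>\<omega>.
        \<bar>LBINT y:{0..1}. G (\<sigma> x) (\<sigma> y) \<omega>
            - (\<integral>\<omega>'. \<bar>\<sigma> x * Z \<omega>' - \<sigma> y * Z' \<omega>'\<bar> \<partial>P)\<bar>\<^sup>2 \<partial>P)"

lemma cond_abs_version_exists:
  assumes "prob_space P"
    and dZ: "distributed P lborel Z std_normal_density"
    and dZ': "distributed P lborel Z' std_normal_density"
    and ind: "prob_space.indep_var P borel Z borel Z'"
  shows "\<exists>G. cond_abs_version P Z Z' G"
proof -
  interpret prob_space P by fact
  have mZ [measurable]: "Z \<in> borel_measurable P" and mZ' [measurable]: "Z' \<in> borel_measurable P"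
    using dZ dZ' by (auto simp: distributed_def)
  let ?F = "vimage_algebra (space P) Z borel"
  let ?D = "distr P borel Z" and ?D' = "distr P borel Z'"
  interpret D: prob_space ?D by (rule prob_space_distr) simp
  interpret D': prob_space ?D' by (rule prob_space_distr) simp
  interpret DD: pair_sigma_finite ?D ?D' ..
  have sub: "subalgebra P ?F"
    unfolding subalgebra_def
    by (auto simp: sets_vimage_algebra2 intro!: measurable_sets[OF mZ])
  interpret finite_measure_subalgebra P ?F by standard (rule sub)
  have joint: "?D \<Otimes>\<^sub>M ?D' = distr P (borel \<Otimes>\<^sub>M borel) (\<lambda>\<omega>. (Z \<omega>, Z' \<omega>))"
    using ind by (simp add: indep_var_distribution_eq)
  have iN: "integrable P U" if "distributed P lborel U std_normal_density" for U
    using distributed_integrable[OF that, of "\<lambda>x. x"] integrable_std_normal_moment[of 1] by simp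
  have iZ: "integrable P Z" and iZ': "integrable P Z'" using iN dZ dZ' by auto
  define H where "H = (\<lambda>x y z. \<integral>w. \<bar>x * z - y * w\<bar> \<partial>?D')"
  have "(\<lambda>p. \<integral>w. \<bar>fst p * snd (snd p) - fst (snd p) * w\<bar> \<partial>?D')
      \<in> borel_measurable (borel \<Otimes>\<^sub>M borel \<Otimes>\<^sub>M borel)"
    by (rule D'.borel_measurable_lebesgue_integral) (simp add: case_prod_beta)
  then have H_meas: "(\<lambda>(x, y, z). H x y z) \<in> borel_measurable (borel \<Otimes>\<^sub>M borel \<Otimes>\<^sub>M borel)"
    by (simp add: H_def case_prod_beta)
  have ZF [measurable]: "Z \<in> borel_measurable ?F"
    by (rule measurable_vimage_algebra1) auto
  have "(\<lambda>(x, y, \<omega>). (x, y, Z \<omega>))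
      \<in> measurable (borel \<Otimes>\<^sub>M borel \<Otimes>\<^sub>M ?F) (borel \<Otimes>\<^sub>M borel \<Otimes>\<^sub>M borel)"
    by measurable
  from measurable_compose[OF this H_meas]
  have G_meas: "(\<lambda>(x, y, \<omega>). H x y (Z \<omega>)) \<in> borel_measurable (borel \<Otimes>\<^sub>M borel \<Otimes>\<^sub>M ?F)"
    by (simp add: case_prod_beta)
  have ver: "AE \<omega> in P. cond_exp_given P Z (\<lambda>\<omega>'. \<bar>x * Z \<omega>' - y * Z' \<omega>'\<bar>) \<omega> = H x y (Z \<omega>)" for x y
    unfolding cond_exp_given_def
  proof (rule real_cond_exp_charact)
    have Hm [measurable]: "H x y \<in> borel_measurable borel"
      using measurable_compose[OF _ H_meas, of "\<lambda>z. (x, y, z)" borel] by simp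
    show int_f: "integrable P (\<lambda>\<omega>'. \<bar>x * Z \<omega>' - y * Z' \<omega>'\<bar>)"
      using iZ iZ' by auto
    then have "integrable (?D \<Otimes>\<^sub>M ?D') (\<lambda>(z, w). \<bar>x * z - y * w\<bar>)"
      unfolding joint by (subst integrable_distr_eq) (auto simp: case_prod_beta)
    from DD.integrable_fst'[OF this]
    have "integrable ?D (H x y)" by (simp add: H_def)
    then show int_g: "integrable P (\<lambda>\<omega>. H x y (Z \<omega>))"
      by (subst (asm) integrable_distr_eq) auto
    show "(\<lambda>\<omega>. H x y (Z \<omega>)) \<in> borel_measurable ?F" by measurable
    fix A assume "A \<in> sets ?F"
    then obtain B where B [measurable]: "B \<in> sets borel" and A: "A = Z -` B \<inter> space P"
      by (auto simp: sets_vimage_algebra2)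
    have ind_A: "indicator A \<omega> = (indicator B (Z \<omega>) :: real)" if "\<omega> \<in> space P" for \<omega>
      using that by (auto simp: A indicator_def)
    have A_P: "A \<in> sets P" unfolding A by measurable
    let ?k = "\<lambda>(z, w). indicator B z * \<bar>x * z - y * w\<bar> :: real"
    have "integrable P (\<lambda>\<omega>. indicator A \<omega> * \<bar>x * Z \<omega> - y * Z' \<omega>\<bar>)"
      using integrable_mult_indicator[OF A_P int_f] by simp
    then have "integrable P (\<lambda>\<omega>. indicator B (Z \<omega>) * \<bar>x * Z \<omega> - y * Z' \<omega>\<bar>)"
      by (subst (asm) Bochner_Integration.integrable_cong[OF refl]) (auto simp: ind_A)
    then have int_k: "integrable (?D \<Otimes>\<^sub>M ?D') ?k"
      unfolding joint by (subst integrable_distr_eq) (auto simp: case_prod_beta)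
    have "(\<integral>\<omega>\<in>A. \<bar>x * Z \<omega> - y * Z' \<omega>\<bar> \<partial>P) = (\<integral>\<omega>. ?k (Z \<omega>, Z' \<omega>) \<partial>P)"
      unfolding set_lebesgue_integral_def
      by (rule Bochner_Integration.integral_cong) (auto simp: ind_A)
    also have "\<dots> = (\<integral>p. ?k p \<partial>(?D \<Otimes>\<^sub>M ?D'))"
      unfolding joint by (subst integral_distr) (auto simp: case_prod_beta)
    also have "\<dots> = (\<integral>z. (\<integral>w. ?k (z, w) \<partial>?D') \<partial>?D)"
      using DD.integral_fst'[OF int_k] by simp
    also have "\<dots> = (\<integral>z. indicator B z * H x y z \<partial>?D)"
      by (simp add: H_def)
    also have "\<dots> = (\<integral>\<omega>. indicator B (Z \<omega>) * H x y (Z \<omega>) \<partial>P)"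
      by (subst integral_distr) auto
    also have "\<dots> = (\<integral>\<omega>\<in>A. H x y (Z \<omega>) \<partial>P)"
      unfolding set_lebesgue_integral_def
      by (rule Bochner_Integration.integral_cong) (auto simp: ind_A)
    finally show "(\<integral>\<omega>\<in>A. \<bar>x * Z \<omega> - y * Z' \<omega>\<bar> \<partial>P) = (\<integral>\<omega>\<in>A. H x y (Z \<omega>) \<partial>P)" .
  qed
  have "cond_abs_version P Z Z' (\<lambda>x y \<omega>. H x y (Z \<omega>))"
    unfolding cond_abs_version_def using G_meas ver by (auto simp: eq_commute)
  then show ?thesis by blast
qed

end

theory Submission
  imports Defs
begin

text \<open>Conditioning on \<open>Z\<close> integrates out \<open>Z'\<close>, so both \<open>\<psi>\<close>-quantities are built from the kernel
  \<open>h x y z = E \<bar>x z - y Z'\<bar> - E \<bar>x Z - y Z'\<bar>\<close>, which is Lipschitz in \<open>(x, y)\<close> with constant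
  \<open>2 (\<bar>z\<bar> + 1)\<close>. Reading the local standard deviations as a step function \<open>u\<close> on \<open>[0,1)\<close>, the
  distance of the estimator to its target is bounded in terms of \<open>W = \<integral> \<bar>u\<^sup>2 - \<sigma>\<^sup>2\<bar>\<close>,
  because \<open>(u - \<sigma>)\<^sup>2 \<le> \<bar>u\<^sup>2 - \<sigma>\<^sup>2\<bar>\<close>; the terms \<open>k = j\<close> left out of \<open>f\<^sub>n\<close> cost \<open>O(1/b\<^sub>n)\<close>.
  It remains to see that \<open>E W\<close> tends to \<open>0\<close>, and by Fubini and dominated convergence it suffices
  that the local variance of the block around \<open>x\<close> converges to \<open>\<sigma>(x)\<^sup>2\<close> in mean at every
  continuity point \<open>x\<close> of \<open>\<sigma>\<close>. This is a weighted law of large numbers for \<open>Y\<^sub>i\<close> and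
  \<open>Y\<^sub>i\<^sup>2\<close>, uniform over blocks.\<close>

section \<open>The law of large numbers under alpha-mixing\<close>

text \<open>The obstacle is integrability. Under the first alternative of the moment hypothesis only
  moments of order 2 + \<delta> are available, so Y_i^2 need not have a variance and a second-moment
  bound cannot be applied to it directly. The law of large numbers is therefore proved in L^1. For
  centred indicators the covariances are bounded by \<alpha>_Y(k), and averaging is an L^1
  contraction, up to a factor 2 for the centring, so approximating y^2 in mean costs the same in
  every block and for every block length. Weights in [-1, 1] are carried along because \<sigma>(i/n)
  varies inside a block. The endpoint 1 needs care: right-continuity forces \<mu> = \<mu>_H on [0,1)
  only, so the observation i = n may have a different mean. It spoils the last block, but a fixed x
  < 1 eventually lies outside that block, and for domination a bound on the mean is enough.\<close>

context prob_space
begin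

section \<open>The law of large numbers for bounded summands\<close>

text \<open>The variance of |f| is nonnegative. Besides \<open>M\<close>, the lemma serves the
  normal law and the uniform law on [0,1).\<close>

lemma expectation_abs_le_sqrt:
  fixes f :: "'a \<Rightarrow> real"
  assumes [measurable]: "f \<in> borel_measurable M" and f2: "integrable M (\<lambda>x. (f x)\<^sup>2)"
  shows "integrable M f" "expectation (\<lambda>x. \<bar>f x\<bar>) \<le> sqrt (expectation (\<lambda>x. (f x)\<^sup>2))"
proof -
  show f1: "integrable M f"
    by (rule square_integrable_imp_integrable) (use f2 in auto)
  have "0 \<le> variance (\<lambda>x. \<bar>f x\<bar>)"
    by (rule variance_positive)
  also have "\<dots> = expectation (\<lambda>x. (f x)\<^sup>2) - (expectation (\<lambda>x. \<bar>f x\<bar>))\<^sup>2"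
    using f1 f2 by (subst variance_eq) auto
  finally show "expectation (\<lambda>x. \<bar>f x\<bar>) \<le> sqrt (expectation (\<lambda>x. (f x)\<^sup>2))"
    by (intro real_le_rsqrt) simp
qed

text \<open>Chebyshev's argument: the second moment of the mean is l^-2 times a double sum of mixed
  moments. At most 2 N l pairs have distance below N and contribute at most 1 each; every other pair
  contributes at most \<epsilon>^2/2. Position and weights enter only through |w i| \<le> 1 and a
  bound depending on the lag alone, so one \<open>L\<close> serves all \<open>m\<close> and
  \<open>w\<close>.\<close>

lemma weighted_mean_tendsto_0:
  fixes \<xi> :: "nat \<Rightarrow> 'a \<Rightarrow> real" and a :: "nat \<Rightarrow> real"
  assumes meas: "\<And>i. 1 \<le> i \<Longrightarrow> \<xi> i \<in> borel_measurable M"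
    and bounded: "\<And>i \<omega>. 1 \<le> i \<Longrightarrow> \<omega> \<in> space M \<Longrightarrow> \<bar>\<xi> i \<omega>\<bar> \<le> 1"
    and corr: "\<And>i k. 1 \<le> i \<Longrightarrow> \<bar>expectation (\<lambda>\<omega>. \<xi> i \<omega> * \<xi> (i + k) \<omega>)\<bar> \<le> a k"
    and a: "a \<longlonglongrightarrow> 0" and "\<epsilon> > 0"
  shows "\<exists>L. \<forall>l\<ge>L. \<forall>m w. (\<forall>i. \<bar>w i\<bar> \<le> 1) \<longrightarrow>
           expectation (\<lambda>\<omega>. \<bar>1 / real l * (\<Sum>i = m + 1..m + l. w i * \<xi> i \<omega>)\<bar>) \<le> \<epsilon>"
proof -
  have "\<epsilon>\<^sup>2 / 2 > 0" using \<open>\<epsilon> > 0\<close> by simp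
  then have "\<forall>\<^sub>F k in sequentially. a k < \<epsilon>\<^sup>2 / 2"
    using a by (rule order_tendstoD(2)[rotated])
  then obtain N where N: "\<And>k. k \<ge> N \<Longrightarrow> a k \<le> \<epsilon>\<^sup>2 / 2"
    unfolding eventually_sequentially by (meson less_imp_le)
  \<comment> \<open>Chosen so that the near-diagonal part 2 N / l is at most \<epsilon>^2/2 for all
    l \<ge> L.\<close>
  obtain L where L: "real L \<ge> 4 * real N / \<epsilon>\<^sup>2" "L \<ge> 1"
    using real_arch_simple[of "max 1 (4 * real N / \<epsilon>\<^sup>2)"] by auto
  have int2: "integrable M (\<lambda>\<omega>. \<xi> i \<omega> * \<xi> j \<omega>)" if "1 \<le> i" "1 \<le> j" for i j
    using meas[OF that(1)] meas[OF that(2)]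
    by (intro integrable_const_bound[of _ 1] AE_I2)
       (auto simp: abs_mult intro!: mult_le_one bounded that)
  have prod1: "\<bar>expectation (\<lambda>\<omega>. \<xi> i \<omega> * \<xi> j \<omega>)\<bar> \<le> 1" if "1 \<le> i" "1 \<le> j" for i j
  proof -
    have "\<bar>expectation (\<lambda>\<omega>. \<xi> i \<omega> * \<xi> j \<omega>)\<bar> \<le> expectation (\<lambda>\<omega>. \<bar>\<xi> i \<omega> * \<xi> j \<omega>\<bar>)"
      by (rule integral_abs_bound)
    also have "\<dots> \<le> expectation (\<lambda>\<omega>. 1)"
    proof (rule integral_mono)
      show "\<bar>\<xi> i \<omega> * \<xi> j \<omega>\<bar> \<le> 1" if "\<omega> \<in> space M" for \<omega>
        unfolding abs_mult using that \<open>1 \<le> i\<close> \<open>1 \<le> j\<close> by (intro mult_le_one bounded) auto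
    qed (use int2[OF that] in auto)
    finally show ?thesis by (simp add: prob_space)
  qed
  \<comment> \<open>The band \<open>{i - N..<i + N}\<close> contains every index at distance less
    than N from i and has at most 2 N elements, also when \<open>i - N\<close> is truncated to
    0.\<close>
  have prod2: "\<bar>expectation (\<lambda>\<omega>. \<xi> i \<omega> * \<xi> j \<omega>)\<bar> \<le> (if j \<in> {i - N..<i + N} then 1 else 0) + \<epsilon>\<^sup>2 / 2"
    if "1 \<le> i" "1 \<le> j" for i j
  proof (cases "j \<in> {i - N..<i + N}")
    case True
    then show ?thesis using prod1[OF that] \<open>\<epsilon>\<^sup>2 / 2 > 0\<close>
      by (simp only: if_True)
  next
    case False
    then consider "i + N \<le> j" | "j + N \<le> i" by force
    then have "\<bar>expectation (\<lambda>\<omega>. \<xi> i \<omega> * \<xi> j \<omega>)\<bar> \<le> \<epsilon>\<^sup>2 / 2"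
    proof cases
      case 1
      then have "N \<le> j - i" "i + (j - i) = j" by auto
      then show ?thesis
        using corr[of i "j - i"] N[of "j - i"] that by simp
    next
      case 2
      then have "N \<le> i - j" "j + (i - j) = i" by auto
      then show ?thesis
        using corr[of j "i - j"] N[of "i - j"] that by (simp add: mult.commute)
    qed
    then show ?thesis using False by auto
  qed
  show ?thesis
  proof (intro exI[of _ L] allI impI)
    fix l m :: nat and w :: "nat \<Rightarrow> real"
    assume "l \<ge> L" and w: "\<forall>i. \<bar>w i\<bar> \<le> 1"
    then have "l \<ge> 1" using L by auto
    let ?I = "{m + 1..m + l}"
    let ?S = "\<lambda>\<omega>. 1 / real l * (\<Sum>i\<in>?I. w i * \<xi> i \<omega>)"
    have sq: "(?S \<omega>)\<^sup>2 = 1 / (real l)\<^sup>2 * (\<Sum>i\<in>?I. \<Sum>j\<in>?I. w i * w j * (\<xi> i \<omega> * \<xi> j \<omega>))" for \<omega>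
      by (simp add: power2_eq_square sum_product algebra_simps)
    have int_sq: "integrable M (\<lambda>\<omega>. (?S \<omega>)\<^sup>2)"
      unfolding sq by (intro integrable_mult_right Bochner_Integration.integrable_sum int2) auto
    have E_sq: "expectation (\<lambda>\<omega>. (?S \<omega>)\<^sup>2)
        = 1 / (real l)\<^sup>2 * (\<Sum>i\<in>?I. \<Sum>j\<in>?I. w i * w j * expectation (\<lambda>\<omega>. \<xi> i \<omega> * \<xi> j \<omega>))"
      unfolding sq
      by (subst integral_mult_right_zero,
          subst Bochner_Integration.integral_sum,
          force intro!: Bochner_Integration.integrable_sum int2 integrable_mult_right,
          intro arg_cong[where f = "\<lambda>x. _ * x"] sum.cong refl,
          subst Bochner_Integration.integral_sum)
         (auto intro!: int2 integrable_mult_right)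
    have "(\<Sum>i\<in>?I. \<Sum>j\<in>?I. w i * w j * expectation (\<lambda>\<omega>. \<xi> i \<omega> * \<xi> j \<omega>))
        \<le> (\<Sum>i\<in>?I. \<Sum>j\<in>?I. (if j \<in> {i - N..<i + N} then 1 else 0) + \<epsilon>\<^sup>2 / 2)"
    proof (intro sum_mono)
      fix i j assume ij: "i \<in> ?I" "j \<in> ?I"
      let ?e = "expectation (\<lambda>\<omega>. \<xi> i \<omega> * \<xi> j \<omega>)"
      have "w i * w j * ?e \<le> \<bar>w i * w j\<bar> * \<bar>?e\<bar>"
        by (metis abs_ge_self abs_mult)
      also have "\<dots> \<le> 1 * \<bar>?e\<bar>"
        using w by (intro mult_right_mono) (auto simp: abs_mult intro!: mult_le_one)
      also have "\<dots> \<le> (if j \<in> {i - N..<i + N} then 1 else 0) + \<epsilon>\<^sup>2 / 2"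
        using prod2[of i j] ij by simp
      finally show "w i * w j * ?e \<le> (if j \<in> {i - N..<i + N} then 1 else 0) + \<epsilon>\<^sup>2 / 2" .
    qed
    also have "\<dots> \<le> (\<Sum>i\<in>?I. 2 * real N + real l * (\<epsilon>\<^sup>2 / 2))"
    proof (intro sum_mono)
      fix i assume "i \<in> ?I"
      have "(\<Sum>j\<in>?I. (if j \<in> {i - N..<i + N} then 1 else 0) :: real) = real (card (?I \<inter> {i - N..<i + N}))"
        by (simp add: sum.If_cases Int_def)
      also have "\<dots> \<le> real (card {i - N..<i + N})"
        by (intro of_nat_mono card_mono) auto
      also have "\<dots> \<le> 2 * real N" by simp
      finally show "(\<Sum>j\<in>?I. (if j \<in> {i - N..<i + N} then 1 else 0) + \<epsilon>\<^sup>2 / 2)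
          \<le> 2 * real N + real l * (\<epsilon>\<^sup>2 / 2)"
        by (simp add: sum.distrib)
    qed
    also have "\<dots> = (real l)\<^sup>2 * (2 * real N / real l + \<epsilon>\<^sup>2 / 2)"
      using \<open>l \<ge> 1\<close> by (simp add: power2_eq_square field_simps)
    finally have "expectation (\<lambda>\<omega>. (?S \<omega>)\<^sup>2)
        \<le> 1 / (real l)\<^sup>2 * ((real l)\<^sup>2 * (2 * real N / real l + \<epsilon>\<^sup>2 / 2))"
      unfolding E_sq by (rule mult_left_mono) simp
    also have "\<dots> = 2 * real N / real l + \<epsilon>\<^sup>2 / 2"
      using \<open>l \<ge> 1\<close> by simp
    finally have "expectation (\<lambda>\<omega>. (?S \<omega>)\<^sup>2) \<le> 2 * real N / real l + \<epsilon>\<^sup>2 / 2" .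
    moreover have "2 * real N / real l \<le> \<epsilon>\<^sup>2 / 2"
    proof -
      have "4 * real N / \<epsilon>\<^sup>2 \<le> real l" using L(1) \<open>l \<ge> L\<close> by linarith
      then show ?thesis using \<open>\<epsilon> > 0\<close> \<open>l \<ge> 1\<close> by (simp add: field_simps)
    qed
    ultimately have "expectation (\<lambda>\<omega>. (?S \<omega>)\<^sup>2) \<le> \<epsilon>\<^sup>2" by linarith
    then have "sqrt (expectation (\<lambda>\<omega>. (?S \<omega>)\<^sup>2)) \<le> \<epsilon>"
      using \<open>\<epsilon> > 0\<close> by (simp add: real_le_lsqrt)
    moreover have "?S \<in> borel_measurable M"
      using meas by (intro borel_measurable_times borel_measurable_sum) auto
    from expectation_abs_le_sqrt(2)[OF this int_sq]
    have "expectation (\<lambda>\<omega>. \<bar>?S \<omega>\<bar>) \<le> sqrt (expectation (\<lambda>\<omega>. (?S \<omega>)\<^sup>2))" .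
    ultimately show "expectation (\<lambda>\<omega>. \<bar>?S \<omega>\<bar>) \<le> \<epsilon>" by linarith
  qed
qed

section \<open>Mixing and stationarity for single coordinates\<close>

lemma vimage_in_sigma_field_of:
  assumes "i \<in> I" "B \<in> sets borel"
  shows "Y i -` B \<inter> space M \<in> sigma_field_of M Y I"
  unfolding sigma_field_of_def using assms by (intro sigma_sets.Basic UN_I[of i]) blast+

text \<open>Both suprema are taken in the reals, so each needs an upper bound on its set before a
  member can be compared with it. The bound 1 does for both; for the outer one the inner set must
  also be nonempty, which the empty event provides.\<close>

lemma alpha_mixing_coeff_bound:
  assumes meas: "\<And>i. 1 \<le> i \<Longrightarrow> Y i \<in> borel_measurable M" and "1 \<le> m"
    and A: "A \<in> sigma_field_of M Y {1..m}" and B: "B \<in> sigma_field_of M Y {k + m..}"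
  shows "\<bar>prob A * prob B - prob (A \<inter> B)\<bar> \<le> alpha_mixing_coeff M Y k"
proof -
  have le1: "\<bar>prob A * prob B - prob C\<bar> \<le> 1" for A B C
    using mult_le_one[OF prob_le_1[of A] measure_nonneg prob_le_1[of B]]
      mult_nonneg_nonneg[OF measure_nonneg[of M A] measure_nonneg[of M B]]
      prob_le_1[of C] measure_nonneg[of M C] by linarith
  have bdd: "bdd_above {\<bar>prob A * prob B - prob (A \<inter> B)\<bar> | A B. A \<in> \<A> \<and> B \<in> \<B>}" for \<A> \<B>
    using le1 by (intro bdd_aboveI[of _ 1]) auto
  have in_field: "{} \<in> sigma_field_of M Y I" for I
    by (auto simp: sigma_field_of_def intro: sigma_sets.Empty)
  have ac1: "alpha_coeff M (sigma_field_of M Y I) (sigma_field_of M Y J) \<le> 1" for I J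
    unfolding alpha_coeff_def
  proof (rule cSup_least)
    show "{\<bar>prob A * prob B - prob (A \<inter> B)\<bar> | A B. A \<in> sigma_field_of M Y I \<and> B \<in> sigma_field_of M Y J} \<noteq> {}"
      using in_field by blast
  qed (use le1 in auto)
  have "\<bar>prob A * prob B - prob (A \<inter> B)\<bar>
      \<le> alpha_coeff M (sigma_field_of M Y {1..m}) (sigma_field_of M Y {k + m..})"
    unfolding alpha_coeff_def using A B by (intro cSup_upper bdd) auto
  also have "\<dots> \<le> alpha_mixing_coeff M Y k"
    unfolding alpha_mixing_coeff_def using \<open>1 \<le> m\<close> ac1
    by (intro cSUP_upper bdd_aboveI[of _ 1]) auto
  finally show ?thesis .
qed

text \<open>Coordinate 1 of the process shifted by h is Y (1 + h); projecting the equality of joint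
  laws and taking h = i - 1 gives the marginal.\<close>

lemma strictly_stationary_distr:
  assumes meas: "\<And>i. 1 \<le> i \<Longrightarrow> Y i \<in> borel_measurable M"
    and stat: "strictly_stationary M Y" and "1 \<le> i"
  shows "distr M borel (Y i) = distr M borel (Y 1)"
proof -
  let ?\<Pi> = "\<Pi>\<^sub>M i\<in>{1::nat..}. (borel :: real measure)"
  let ?f = "\<lambda>h \<omega>. \<lambda>i\<in>{1..}. Y (i + h) \<omega>"
  have f: "?f h \<in> measurable M ?\<Pi>" for h
    using meas by (intro measurable_restrict) auto
  have "distr M borel (Y (1 + h)) = distr (distr M ?\<Pi> (?f h)) borel (\<lambda>x. x 1)" for h
    by (subst distr_distr[OF _ f]) (auto simp: comp_def)
  moreover have "distr M ?\<Pi> (?f h) = distr M ?\<Pi> (?f 0)" for h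
    using stat by (simp add: strictly_stationary_def)
  ultimately have "distr M borel (Y (1 + h)) = distr M borel (Y (1 + 0))" for h
    by metis
  from this[of "i - 1"] show ?thesis using \<open>1 \<le> i\<close> by simp
qed

section \<open>From bounded to integrable functions\<close>

lemma expectation_dominated:
  fixes f g :: "'a \<Rightarrow> real"
  assumes "f \<in> borel_measurable M" "integrable M g" "\<And>\<omega>. \<omega> \<in> space M \<Longrightarrow> \<bar>f \<omega>\<bar> \<le> g \<omega>"
  shows "integrable M f" "expectation f \<le> expectation g"
    "\<bar>expectation f\<bar> \<le> expectation g"
proof -
  show i: "integrable M f"
    using assms(2,1) by (rule Bochner_Integration.integrable_bound) (use assms(3) in force)
  show "expectation f \<le> expectation g"
    using i assms by (intro integral_mono) fastforce+
  have "\<bar>expectation f\<bar> \<le> expectation (\<lambda>x. \<bar>f x\<bar>)" by (rule integral_abs_bound)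
  also have "\<dots> \<le> expectation g" using i assms by (intro integral_mono) auto
  finally show "\<bar>expectation f\<bar> \<le> expectation g" .
qed

text \<open>The L^1 contraction that makes an approximation error in the summands independent of
  block length, position and weights.\<close>

lemma abs_mean_le:
  fixes w :: "nat \<Rightarrow> real"
  assumes int: "\<And>i. 1 \<le> i \<Longrightarrow> integrable M (\<xi> i)" and w: "\<And>i. \<bar>w i\<bar> \<le> 1"
    and bound: "\<And>i. 1 \<le> i \<Longrightarrow> expectation (\<lambda>\<omega>. \<bar>\<xi> i \<omega>\<bar>) \<le> K" and "K \<ge> 0"
  shows "expectation (\<lambda>\<omega>. \<bar>1 / real l * (\<Sum>i = m + 1..m + l. w i * \<xi> i \<omega>)\<bar>) \<le> K"
proof -
  have "expectation (\<lambda>\<omega>. \<bar>1 / real l * (\<Sum>i = m + 1..m + l. w i * \<xi> i \<omega>)\<bar>)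
      \<le> expectation (\<lambda>\<omega>. 1 / real l * (\<Sum>i = m + 1..m + l. \<bar>\<xi> i \<omega>\<bar>))"
  proof (rule integral_mono)
    show "\<bar>1 / real l * (\<Sum>i = m + 1..m + l. w i * \<xi> i \<omega>)\<bar> \<le> 1 / real l * (\<Sum>i = m + 1..m + l. \<bar>\<xi> i \<omega>\<bar>)" for \<omega>
      unfolding abs_mult
      by (intro mult_mono order_trans[OF sum_abs] sum_mono)
         (auto simp: abs_mult w intro!: mult_left_le_one_le)
  qed (auto intro!: integrable_mult_right Bochner_Integration.integrable_sum integrable_abs int
        integrable_divide)
  also have "\<dots> = 1 / real l * (\<Sum>i = m + 1..m + l. expectation (\<lambda>\<omega>. \<bar>\<xi> i \<omega>\<bar>))"
    by (subst integral_mult_right_zero, subst Bochner_Integration.integral_sum) (auto intro!: int)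
  also have "\<dots> \<le> 1 / real l * (\<Sum>i = m + 1..m + l. K)"
    by (intro mult_left_mono sum_mono bound) auto
  \<comment> \<open>For l = 0 the left side is 0, since 1 / 0 = 0; this case needs K \<ge>
    0.\<close>
  also have "\<dots> \<le> K" using \<open>K \<ge> 0\<close> by simp
  finally show ?thesis .
qed

text \<open>Mixing gives the law for indicators; it passes to sums and to limits in mean, hence to
  all integrable functions.\<close>

lemma alpha_mixing_weighted_LLN:
  fixes \<phi> :: "real \<Rightarrow> real"
  assumes meas: "\<And>i. 1 \<le> i \<Longrightarrow> Y i \<in> borel_measurable M"
    and stat: "strictly_stationary M Y" and mixing: "alpha_mixing M Y"
    and int: "integrable M (\<lambda>\<omega>. \<phi> (Y 1 \<omega>))" and [measurable]: "\<phi> \<in> borel_measurable borel"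
    and "\<epsilon> > 0"
  shows "\<exists>L. \<forall>l\<ge>L. \<forall>m w. (\<forall>i. \<bar>w i\<bar> \<le> 1) \<longrightarrow>
           expectation (\<lambda>\<omega>. \<bar>1 / real l * (\<Sum>i = m + 1..m + l.
             w i * (\<phi> (Y i \<omega>) - expectation (\<lambda>\<omega>. \<phi> (Y 1 \<omega>))))\<bar>) \<le> \<epsilon>"
proof -
  note [measurable] = meas
  let ?D = "distr M borel (Y 1)"
  \<comment> \<open>The centring is an integral under the common law \<open>?D\<close> of the Y i,
    so that \<open>A\<close> depends only on a function on the real line and induction over
    functions integrable under \<open>?D\<close> becomes possible. \<open>R\<close> is the property
    carried through that induction.\<close>
  define A where "A = (\<lambda>\<phi> l m w. expectation (\<lambda>\<omega>. \<bar>1 / real l * (\<Sum>i = m + 1..m + l.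
             w i * (\<phi> (Y i \<omega>) - (\<integral>y. \<phi> y \<partial>?D)))\<bar>))"
  define R where "R = (\<lambda>\<phi>. \<forall>\<epsilon>>0. \<exists>L. \<forall>l\<ge>L. \<forall>m w. (\<forall>i. \<bar>w i :: real\<bar> \<le> 1) \<longrightarrow> A \<phi> l m w \<le> \<epsilon>)"
  have dist: "distr M borel (Y i) = ?D" if "1 \<le> i" for i
    by (rule strictly_stationary_distr[OF meas stat that]) auto
  have intY: "integrable M (\<lambda>\<omega>. f (Y i \<omega>))" if "integrable ?D f" "1 \<le> i" for f :: "real \<Rightarrow> real" and i
  proof -
    have "integrable (distr M borel (Y i)) f" using that(1) dist[OF that(2)] by simp
    then show ?thesis using that
      by (subst (asm) integrable_distr_eq) (auto intro: meas)
  qed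
  have EY: "expectation (\<lambda>\<omega>. f (Y i \<omega>)) = (\<integral>y. f y \<partial>?D)"
    if "f \<in> borel_measurable borel" "1 \<le> i" for f :: "real \<Rightarrow> real" and i
    using that by (subst dist[OF that(2), symmetric], subst integral_distr) auto
  interpret D: prob_space ?D by (rule prob_space_distr) (auto intro: meas)
  have intA: "integrable M (\<lambda>\<omega>. \<bar>1 / real l * (\<Sum>i = m + 1..m + l. w i * (f (Y i \<omega>) - (\<integral>y. f y \<partial>?D)))\<bar>)"
    if "integrable ?D f" for f l m w
    by (intro integrable_mult_right Bochner_Integration.integrable_sum integrable_abs
        Bochner_Integration.integrable_diff intY[OF that]) auto
  have A_add: "A (\<lambda>y. f y + g y) l m w \<le> A f l m w + A g l m w"
    if f: "integrable ?D f" and g: "integrable ?D g" for f g l m w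
  proof -
    have "A (\<lambda>y. f y + g y) l m w
      \<le> expectation (\<lambda>\<omega>. \<bar>1 / real l * (\<Sum>i = m + 1..m + l. w i * (f (Y i \<omega>) - (\<integral>y. f y \<partial>?D)))\<bar>
       + \<bar>1 / real l * (\<Sum>i = m + 1..m + l. w i * (g (Y i \<omega>) - (\<integral>y. g y \<partial>?D)))\<bar>)"
      unfolding A_def
    proof (rule integral_mono)
      fix \<omega>
      have "(\<Sum>i = m + 1..m + l. w i * (f (Y i \<omega>) + g (Y i \<omega>) - (\<integral>y. f y + g y \<partial>?D)))
        = (\<Sum>i = m + 1..m + l. w i * (f (Y i \<omega>) - (\<integral>y. f y \<partial>?D)))
          + (\<Sum>i = m + 1..m + l. w i * (g (Y i \<omega>) - (\<integral>y. g y \<partial>?D)))"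
        using f g by (simp add: sum.distrib[symmetric] algebra_simps)
      then show "\<bar>1 / real l * (\<Sum>i = m + 1..m + l. w i * (f (Y i \<omega>) + g (Y i \<omega>) - (\<integral>y. f y + g y \<partial>?D)))\<bar>
         \<le> \<bar>1 / real l * (\<Sum>i = m + 1..m + l. w i * (f (Y i \<omega>) - (\<integral>y. f y \<partial>?D)))\<bar>
         + \<bar>1 / real l * (\<Sum>i = m + 1..m + l. w i * (g (Y i \<omega>) - (\<integral>y. g y \<partial>?D)))\<bar>"
        by (simp only: distrib_left abs_triangle_ineq)
    qed (intro Bochner_Integration.integrable_add intA[of "\<lambda>y. f y + g y"] intA f g)+
    also have "\<dots> = A f l m w + A g l m w"
      unfolding A_def by (intro Bochner_Integration.integral_add intA f g)
    finally show ?thesis .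
  qed
  \<comment> \<open>One copy of the L^1 norm comes from f (Y i), the other from its mean.\<close>
  have A_le: "A f l m w \<le> 2 * (\<integral>y. \<bar>f y\<bar> \<partial>?D)"
    if f: "integrable ?D f" and w: "\<And>i. \<bar>w i\<bar> \<le> 1" for f :: "real \<Rightarrow> real" and l m w
    unfolding A_def
  proof (rule abs_mean_le[OF _ w])
    fix i :: nat assume i: "1 \<le> i"
    show int: "integrable M (\<lambda>\<omega>. f (Y i \<omega>) - (\<integral>y. f y \<partial>?D))"
      using intY[OF f i] by simp
    have "expectation (\<lambda>\<omega>. \<bar>f (Y i \<omega>) - (\<integral>y. f y \<partial>?D)\<bar>)
        \<le> expectation (\<lambda>\<omega>. \<bar>f (Y i \<omega>)\<bar> + \<bar>\<integral>y. f y \<partial>?D\<bar>)"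
      using int intY[OF f i]
      by (intro integral_mono Bochner_Integration.integrable_add integrable_abs)
         (auto simp only: abs_triangle_ineq4 finite_measure.integrable_const)
    also have "\<dots> = expectation (\<lambda>\<omega>. \<bar>f (Y i \<omega>)\<bar>) + \<bar>\<integral>y. f y \<partial>?D\<bar>"
      using intY[OF f i] by (subst Bochner_Integration.integral_add) (auto simp: prob_space)
    also have "expectation (\<lambda>\<omega>. \<bar>f (Y i \<omega>)\<bar>) = (\<integral>y. \<bar>f y\<bar> \<partial>?D)"
      using f i by (intro EY) auto
    also have "\<bar>\<integral>y. f y \<partial>?D\<bar> \<le> (\<integral>y. \<bar>f y\<bar> \<partial>?D)"
      by (rule integral_abs_bound)
    finally show "expectation (\<lambda>\<omega>. \<bar>f (Y i \<omega>) - (\<integral>y. f y \<partial>?D)\<bar>) \<le> 2 * (\<integral>y. \<bar>f y\<bar> \<partial>?D)"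
      by simp
  qed auto
  \<comment> \<open>Subadditivity for f = g + (f - g), with the contraction applied to f -
    g.\<close>
  have approx: "A f l m w \<le> A g l m w + 2 * (\<integral>y. \<bar>f y - g y\<bar> \<partial>?D)"
    if f: "integrable ?D f" and g: "integrable ?D g" and w: "\<And>i. \<bar>w i\<bar> \<le> 1" for f g l m w
    using A_add[OF g, of "\<lambda>y. f y - g y" l m w] A_le[of "\<lambda>y. f y - g y" w l m] f g w by simp
  have A_scale: "A (\<lambda>y. c * f y) l m w = \<bar>c\<bar> * A f l m w" for c f l m w
  proof -
    have "(\<Sum>i = m + 1..m + l. w i * (c * f (Y i \<omega>) - (\<integral>y. c * f y \<partial>?D)))
        = c * (\<Sum>i = m + 1..m + l. w i * (f (Y i \<omega>) - (\<integral>y. f y \<partial>?D)))" for \<omega>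
      by (simp add: sum_distrib_left algebra_simps)
    then have "\<bar>1 / real l * (\<Sum>i = m + 1..m + l. w i * (c * f (Y i \<omega>) - (\<integral>y. c * f y \<partial>?D)))\<bar>
        = \<bar>c\<bar> * \<bar>1 / real l * (\<Sum>i = m + 1..m + l. w i * (f (Y i \<omega>) - (\<integral>y. f y \<partial>?D)))\<bar>" for \<omega>
      by (simp add: abs_mult)
    then show ?thesis by (simp only: A_def integral_mult_right_zero)
  qed
  have "integrable ?D \<phi>"
    using int by (subst integrable_distr_eq) (auto intro: meas)
  then have "R \<phi>"
  proof (induction rule: integrable_induct)
    case (base B c)
    then have [measurable]: "B \<in> sets borel" by simp
    define p where "p = (\<integral>y. indicator B y \<partial>?D :: real)"
    let ?\<xi> = "\<lambda>i \<omega>. indicator B (Y i \<omega>) - p"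
    have p: "p = prob (Y i -` B \<inter> space M)" if "1 \<le> i" for i
    proof -
      have "p = measure (distr M borel (Y i)) B"
        using dist[OF that] by (simp add: p_def)
      then show ?thesis using that by (simp add: measure_distr)
    qed
    have p01: "0 \<le> p" "p \<le> 1" using p[of 1] by auto
    \<comment> \<open>The covariance of the indicators of an event of the past up to i and an event
      of the future from i + k is exactly what the mixing coefficient at lag k bounds, with the cut
      m = i.\<close>
    have corr: "\<bar>expectation (\<lambda>\<omega>. ?\<xi> i \<omega> * ?\<xi> (i + k) \<omega>)\<bar> \<le> alpha_mixing_coeff M Y k"
      if "1 \<le> i" for i k
    proof -
      let ?E = "Y i -` B \<inter> space M" and ?F = "Y (i + k) -` B \<inter> space M"
      have [measurable]: "?E \<in> sets M" "?F \<in> sets M" using that by (auto intro!: measurable_sets meas)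
      have "expectation (\<lambda>\<omega>. ?\<xi> i \<omega> * ?\<xi> (i + k) \<omega>)
          = expectation (\<lambda>\<omega>. indicator (?E \<inter> ?F) \<omega> - p * indicator ?E \<omega> - p * indicator ?F \<omega> + p * p)"
        by (rule Bochner_Integration.integral_cong) (auto simp: indicator_def algebra_simps)
      also have "\<dots> = prob (?E \<inter> ?F) - prob ?E * prob ?F"
        using p[of i] p[of "i + k"] that
        by (simp add: prob_space emeasure_eq_measure)
      finally have "expectation (\<lambda>\<omega>. ?\<xi> i \<omega> * ?\<xi> (i + k) \<omega>) = prob (?E \<inter> ?F) - prob ?E * prob ?F" .
      moreover have "?E \<in> sigma_field_of M Y {1..i}" "?F \<in> sigma_field_of M Y {k + i..}"
        using that \<open>B \<in> sets borel\<close> by (auto intro!: vimage_in_sigma_field_of)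
      from alpha_mixing_coeff_bound[OF meas that this]
      have "\<bar>prob ?E * prob ?F - prob (?E \<inter> ?F)\<bar> \<le> alpha_mixing_coeff M Y k" by simp
      ultimately show ?thesis by simp
    qed
    have "R (\<lambda>y. c * indicator B y)"
      unfolding R_def
    proof (intro allI impI)
      fix \<epsilon> :: real assume "\<epsilon> > 0"
      \<comment> \<open>The summand 1 in the denominator covers c = 0.\<close>
      then have "\<epsilon> / (\<bar>c\<bar> + 1) > 0" by (simp add: divide_pos_pos)
      with corr mixing have "\<exists>L. \<forall>l\<ge>L. \<forall>m w. (\<forall>i. \<bar>w i\<bar> \<le> 1) \<longrightarrow>
           expectation (\<lambda>\<omega>. \<bar>1 / real l * (\<Sum>i = m + 1..m + l. w i * ?\<xi> i \<omega>)\<bar>) \<le> \<epsilon> / (\<bar>c\<bar> + 1)"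
        using p01 by (intro weighted_mean_tendsto_0[where a = "alpha_mixing_coeff M Y"])
          (auto simp: alpha_mixing_def indicator_def)
      then obtain L where L: "\<And>l m w. l \<ge> L \<Longrightarrow> (\<forall>i. \<bar>w i\<bar> \<le> 1) \<Longrightarrow> A (indicator B) l m w \<le> \<epsilon> / (\<bar>c\<bar> + 1)"
        unfolding A_def p_def by blast
      have "\<bar>c\<bar> * (\<epsilon> / (\<bar>c\<bar> + 1)) \<le> \<epsilon>" using \<open>\<epsilon> > 0\<close> by (simp add: field_simps)
      then have "\<bar>c\<bar> * A (indicator B) l m w \<le> \<epsilon>" if "l \<ge> L" "\<forall>i. \<bar>w i\<bar> \<le> 1" for l m w
        using mult_left_mono[OF L[OF that, of m], of "\<bar>c\<bar>"] by linarith
      then show "\<exists>L. \<forall>l\<ge>L. \<forall>m w. (\<forall>i. \<bar>w i\<bar> \<le> 1) \<longrightarrow> A (\<lambda>y. c * indicator B y) l m w \<le> \<epsilon>"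
        unfolding A_scale by blast
    qed
    then show ?case by (simp add: mult.commute)
  next
    case (add f g)
    show ?case unfolding R_def
    proof (intro allI impI)
      fix \<epsilon> :: real assume "\<epsilon> > 0"
      then have "\<epsilon> / 2 > 0" by simp
      from add.IH(1)[unfolded R_def, rule_format, OF this] obtain L1 where
        L1: "\<And>l m w. l \<ge> L1 \<Longrightarrow> (\<forall>i. \<bar>w i\<bar> \<le> 1) \<Longrightarrow> A f l m w \<le> \<epsilon> / 2" by blast
      from add.IH(2)[unfolded R_def, rule_format, OF \<open>\<epsilon> / 2 > 0\<close>] obtain L2 where
        L2: "\<And>l m w. l \<ge> L2 \<Longrightarrow> (\<forall>i. \<bar>w i\<bar> \<le> 1) \<Longrightarrow> A g l m w \<le> \<epsilon> / 2" by blast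
      have "A (\<lambda>y. f y + g y) l m w \<le> \<epsilon>" if "l \<ge> max L1 L2" "\<forall>i. \<bar>w i\<bar> \<le> 1" for l m w
        using A_add[OF add.hyps, of l m w] L1[of l w m] L2[of l w m] that by simp
      then show "\<exists>L. \<forall>l\<ge>L. \<forall>m w. (\<forall>i. \<bar>w i\<bar> \<le> 1) \<longrightarrow> A (\<lambda>y. f y + g y) l m w \<le> \<epsilon>" by blast
    qed
  next
    case (lim f s)
    show ?case unfolding R_def
    proof (intro allI impI)
      fix \<epsilon> :: real assume "\<epsilon> > 0"
      \<comment> \<open>The induction rule supplies pointwise limits with |s n| \<le> 2 |f|; hence
        |f - s n| \<le> 3 |f|, and dominated convergence turns the limit into one in mean.\<close>
      have "(\<lambda>n. \<integral>y. \<bar>f y - s n y\<bar> \<partial>?D) \<longlonglongrightarrow> (\<integral>y. 0 \<partial>?D)"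
      proof (rule integral_dominated_convergence[where w = "\<lambda>y. 3 * \<bar>f y\<bar>"])
        show "AE y in ?D. (\<lambda>n. \<bar>f y - s n y\<bar>) \<longlonglongrightarrow> 0"
          using lim.hyps(2) by (intro AE_I2 tendsto_eq_intros) (auto intro!: tendsto_eq_intros)
        show "AE y in ?D. norm \<bar>f y - s n y\<bar> \<le> 3 * \<bar>f y\<bar>" for n
          using lim.hyps(3)[of _ n] by (intro AE_I2) fastforce
      qed (use lim.hyps in auto)
      then have "\<forall>\<^sub>F n in sequentially. (\<integral>y. \<bar>f y - s n y\<bar> \<partial>?D) < \<epsilon> / 4"
        using \<open>\<epsilon> > 0\<close> by (intro order_tendstoD(2)[where y = 0]) auto
      \<comment> \<open>\<open>approx\<close> doubles this distance, so \<epsilon>/4 here leaves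
        \<epsilon>/2 for the law of large numbers for \<open>s n\<close>.\<close>
      then obtain n where n: "(\<integral>y. \<bar>f y - s n y\<bar> \<partial>?D) < \<epsilon> / 4"
        using eventually_happens'[OF sequentially_bot] by blast
      have "\<epsilon> / 2 > 0" using \<open>\<epsilon> > 0\<close> by simp
      from lim.IH[unfolded R_def, rule_format, OF this, of n] obtain L where
        L: "\<And>l m w. l \<ge> L \<Longrightarrow> (\<forall>i. \<bar>w i\<bar> \<le> 1) \<Longrightarrow> A (s n) l m w \<le> \<epsilon> / 2"
        by blast
      have "A f l m w \<le> \<epsilon>" if "l \<ge> L" "\<forall>i. \<bar>w i\<bar> \<le> 1" for l m w
        using L[OF that, of m] approx[OF lim.hyps(4) lim.hyps(1)[of n], of w l m] n that(2) by auto
      then show "\<exists>L. \<forall>l\<ge>L. \<forall>m w. (\<forall>i. \<bar>w i\<bar> \<le> 1) \<longrightarrow> A f l m w \<le> \<epsilon>" by blast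
    qed
  qed
  moreover have "(\<integral>y. \<phi> y \<partial>?D) = expectation (\<lambda>\<omega>. \<phi> (Y 1 \<omega>))"
    using EY[of \<phi> 1] by simp
  ultimately show ?thesis
    using \<open>\<epsilon> > 0\<close> unfolding R_def A_def by simp
qed

end

section \<open>The Gaussian kernel\<close>

text \<open>The version of E(|x Z - y Z'| | Z = z) that is defined for every z and measurable in (x,
  y, z) jointly.\<close>

definition gauss_abs :: "real \<Rightarrow> real \<Rightarrow> real \<Rightarrow> real" where
  "gauss_abs x y z = (\<integral>w. \<bar>x * z - y * w\<bar> \<partial>std_normal_distribution)"

text \<open>The mean is written as an iterated integral, so that the kernel refers to the normal law
  only and not to \<open>P\<close>; \<open>cond_exp_given_std_normal\<close> identifies it with E|x
  Z - y Z'|.\<close>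

definition gauss_abs_centred :: "real \<Rightarrow> real \<Rightarrow> real \<Rightarrow> real" where
  "gauss_abs_centred x y z = gauss_abs x y z - (\<integral>z'. gauss_abs x y z' \<partial>std_normal_distribution)"

interpretation std_normal: real_distribution std_normal_distribution
  by (rule real_dist_normal_dist)

lemma integrable_std_normal_ident:
  "integrable std_normal_distribution (\<lambda>w. w)" "integrable std_normal_distribution (\<lambda>w. w\<^sup>2)"
  using integrable_std_normal_distribution_moment[of 1] integrable_std_normal_distribution_moment[of 2]
  by auto

lemma std_normal_prob_UNIV: "std_normal.prob UNIV = 1"
  using std_normal.prob_space unfolding std_normal.space_eq_univ .

lemma std_normal_second_moment: "(\<integral>w. w\<^sup>2 \<partial>std_normal_distribution) = 1"
proof -
  have "(\<integral>w. w\<^sup>2 \<partial>std_normal_distribution) = fact (2 * 1) / (2 ^ 1 * fact 1)"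
    using std_normal_distribution_even_moments(1)[of 1] unfolding mult_1_right .
  also have "\<dots> = 1" by (simp add: fact_2)
  finally show ?thesis .
qed

text \<open>The exact value is sqrt (2 / pi); the bound 1 keeps the Lipschitz constants
  simple.\<close>

lemma std_normal_abs_moment_le: "(\<integral>w. \<bar>w\<bar> \<partial>std_normal_distribution) \<le> 1"
proof -
  have "(\<integral>w. \<bar>w\<bar> \<partial>std_normal_distribution) \<le> sqrt (\<integral>w. w\<^sup>2 \<partial>std_normal_distribution)"
    by (rule std_normal.expectation_abs_le_sqrt(2)[OF _ integrable_std_normal_ident(2)]) simp
  then show ?thesis unfolding std_normal_second_moment real_sqrt_one .
qed

lemma gauss_abs_measurable [measurable (raw)]:
  assumes [measurable]: "f \<in> borel_measurable K" "g \<in> borel_measurable K" "h \<in> borel_measurable K"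
  shows "(\<lambda>x. gauss_abs (f x) (g x) (h x)) \<in> borel_measurable K"
  unfolding gauss_abs_def
  by (rule std_normal.borel_measurable_lebesgue_integral) (auto simp: case_prod_beta)

lemma gauss_abs_centred_measurable [measurable (raw)]:
  assumes [measurable]: "f \<in> borel_measurable K" "g \<in> borel_measurable K" "h \<in> borel_measurable K"
  shows "(\<lambda>x. gauss_abs_centred (f x) (g x) (h x)) \<in> borel_measurable K"
  unfolding gauss_abs_centred_def by (intro borel_measurable_diff gauss_abs_measurable assms) simp

text \<open>The reverse triangle inequality inside the integral, followed by E|Z'| \<le> 1.\<close>

lemma gauss_abs_diff:
  "\<bar>gauss_abs x y z - gauss_abs x' y' z\<bar> \<le> \<bar>x - x'\<bar> * \<bar>z\<bar> + \<bar>y - y'\<bar>"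
proof -
  note int = integrable_std_normal_ident(1)
  have "\<bar>gauss_abs x y z - gauss_abs x' y' z\<bar>
      = \<bar>\<integral>w. \<bar>x * z - y * w\<bar> - \<bar>x' * z - y' * w\<bar> \<partial>std_normal_distribution\<bar>"
    unfolding gauss_abs_def using int by (subst Bochner_Integration.integral_diff) auto
  also have "\<dots> \<le> (\<integral>w. \<bar>x - x'\<bar> * \<bar>z\<bar> + \<bar>y - y'\<bar> * \<bar>w\<bar> \<partial>std_normal_distribution)"
  proof (rule std_normal.expectation_dominated(3))
    show "\<bar>\<bar>x * z - y * w\<bar> - \<bar>x' * z - y' * w\<bar>\<bar> \<le> \<bar>x - x'\<bar> * \<bar>z\<bar> + \<bar>y - y'\<bar> * \<bar>w\<bar>" for w
    proof -
      have "\<bar>\<bar>x * z - y * w\<bar> - \<bar>x' * z - y' * w\<bar>\<bar> \<le> \<bar>(x - x') * z - (y - y') * w\<bar>"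
        by (rule order_trans[OF abs_triangle_ineq3]) (simp add: algebra_simps)
      also have "\<dots> \<le> \<bar>x - x'\<bar> * \<bar>z\<bar> + \<bar>y - y'\<bar> * \<bar>w\<bar>"
        by (rule order_trans[OF abs_triangle_ineq4]) (simp add: abs_mult)
      finally show ?thesis .
    qed
  qed (measurable, intro Bochner_Integration.integrable_add integrable_mult_right integrable_abs int, simp)
  also have "\<dots> = \<bar>x - x'\<bar> * \<bar>z\<bar> + \<bar>y - y'\<bar> * (\<integral>w. \<bar>w\<bar> \<partial>std_normal_distribution)"
    using int by (simp add: std_normal_prob_UNIV)
  also have "\<dots> \<le> \<bar>x - x'\<bar> * \<bar>z\<bar> + \<bar>y - y'\<bar>"
    using std_normal_abs_moment_le by (simp add: mult_left_le)
  finally show ?thesis .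
qed

lemma gauss_abs_0: "gauss_abs 0 0 z = 0"
  by (simp add: gauss_abs_def)

lemma integrable_std_normal_abs_affine:
  "integrable std_normal_distribution (\<lambda>w. c * \<bar>w\<bar> + d)"
  by (intro Bochner_Integration.integrable_add integrable_mult_right integrable_abs
      integrable_std_normal_ident(1)) simp

lemma integrable_gauss_abs: "integrable std_normal_distribution (gauss_abs x y)"
proof (rule std_normal.expectation_dominated(1)[OF _ integrable_std_normal_abs_affine[of "\<bar>x\<bar>" "\<bar>y\<bar>"]])
  show "\<bar>gauss_abs x y z\<bar> \<le> \<bar>x\<bar> * \<bar>z\<bar> + \<bar>y\<bar>" for z
    using gauss_abs_diff[of x y z 0 0] by (simp add: gauss_abs_0)
  show "gauss_abs x y \<in> borel_measurable std_normal_distribution"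
    by (rule gauss_abs_measurable) simp_all
qed

text \<open>The uncentred kernel moves by at most |x - x'| |z| + |y - y'| and its mean by at most |x
  - x'| + |y - y'|. The common factor 2 (|z| + 1) is generous but symmetric in both
  arguments.\<close>

lemma gauss_abs_centred_diff:
  "\<bar>gauss_abs_centred x y z - gauss_abs_centred x' y' z\<bar>
     \<le> 2 * (\<bar>z\<bar> + 1) * (\<bar>x - x'\<bar> + \<bar>y - y'\<bar>)"
proof -
  have "\<bar>(\<integral>z. gauss_abs x y z \<partial>std_normal_distribution) - (\<integral>z. gauss_abs x' y' z \<partial>std_normal_distribution)\<bar>
      = \<bar>\<integral>z. gauss_abs x y z - gauss_abs x' y' z \<partial>std_normal_distribution\<bar>"
    by (simp add: integrable_gauss_abs)
  also have "\<dots> \<le> (\<integral>z. \<bar>x - x'\<bar> * \<bar>z\<bar> + \<bar>y - y'\<bar> \<partial>std_normal_distribution)"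
    by (rule std_normal.expectation_dominated(3)[OF _ integrable_std_normal_abs_affine
          gauss_abs_diff]) measurable
  also have "\<dots> = \<bar>x - x'\<bar> * (\<integral>w. \<bar>w\<bar> \<partial>std_normal_distribution) + \<bar>y - y'\<bar>"
    using integrable_std_normal_ident(1) by (simp add: std_normal_prob_UNIV)
  also have "\<dots> \<le> \<bar>x - x'\<bar> + \<bar>y - y'\<bar>"
    using std_normal_abs_moment_le by (simp add: mult_left_le)
  finally have "\<bar>gauss_abs_centred x y z - gauss_abs_centred x' y' z\<bar>
      \<le> (\<bar>x - x'\<bar> * \<bar>z\<bar> + \<bar>y - y'\<bar>) + (\<bar>x - x'\<bar> + \<bar>y - y'\<bar>)"
    using gauss_abs_diff[of x y z x' y'] unfolding gauss_abs_centred_def by linarith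
  also have "\<dots> \<le> 2 * (\<bar>z\<bar> + 1) * (\<bar>x - x'\<bar> + \<bar>y - y'\<bar>)"
    by (simp add: algebra_simps)
  finally show ?thesis .
qed

lemma gauss_abs_centred_bound:
  "\<bar>gauss_abs_centred x y z\<bar> \<le> 2 * (\<bar>z\<bar> + 1) * (\<bar>x\<bar> + \<bar>y\<bar>)"
proof -
  have "gauss_abs_centred 0 0 z = 0"
    by (simp add: gauss_abs_centred_def gauss_abs_def)
  then show ?thesis
    using gauss_abs_centred_diff[of x y z 0 0] by (simp only: diff_zero)
qed

text \<open>The functional is quadratic in the kernel, so the square of the Lipschitz constant has
  to be integrated over z.\<close>

lemma integrable_gauss_weight: "integrable std_normal_distribution (\<lambda>z. (2 * (\<bar>z\<bar> + 1))\<^sup>2)"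
proof -
  have "integrable std_normal_distribution (\<lambda>z. 4 * z\<^sup>2 + 8 * \<bar>z\<bar> + 4)"
    by (intro Bochner_Integration.integrable_add integrable_mult_right integrable_abs
        integrable_std_normal_ident) simp
  moreover have "(2 * (\<bar>z\<bar> + 1))\<^sup>2 = 4 * z\<^sup>2 + 8 * \<bar>z\<bar> + 4" for z :: real
    unfolding power_mult_distrib power2_sum power2_abs by simp
  ultimately show ?thesis by (simp only:)
qed

section \<open>Conditioning on Z and reduction to the normal law\<close>

text \<open>The freezing lemma. Sets of the sigma-field generated by Z are preimages of Borel sets
  B, and by independence the joint law is a product; Fubini for the integrand cut off to z in B
  gives the defining property of conditional expectation.\<close>

lemma cond_exp_given_indep:
  fixes g :: "real \<Rightarrow> real \<Rightarrow> real"
  assumes "prob_space P" and [measurable]: "Z \<in> borel_measurable P" "Z' \<in> borel_measurable P"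
    and ind: "prob_space.indep_var P borel Z borel Z'"
    and g [measurable]: "(\<lambda>(z, w). g z w) \<in> borel_measurable (borel \<Otimes>\<^sub>M borel)"
    and int: "integrable P (\<lambda>\<omega>. g (Z \<omega>) (Z' \<omega>))"
  shows "AE \<omega> in P. cond_exp_given P Z (\<lambda>\<omega>. g (Z \<omega>) (Z' \<omega>)) \<omega> = (\<integral>w. g (Z \<omega>) w \<partial>distr P borel Z')"
proof -
  interpret prob_space P by fact
  let ?F = "vimage_algebra (space P) Z borel"
  let ?D = "distr P borel Z" and ?D' = "distr P borel Z'"
  interpret D: prob_space ?D by (rule prob_space_distr) simp
  interpret D': prob_space ?D' by (rule prob_space_distr) simp
  interpret DD: pair_sigma_finite ?D ?D' ..
  have "subalgebra P ?F"
    unfolding subalgebra_def by (auto simp: sets_vimage_algebra2 intro!: measurable_sets)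
  then interpret finite_measure_subalgebra P ?F by unfold_locales
  have joint: "?D \<Otimes>\<^sub>M ?D' = distr P (borel \<Otimes>\<^sub>M borel) (\<lambda>\<omega>. (Z \<omega>, Z' \<omega>))"
    using ind by (simp add: indep_var_distribution_eq)
  have intDD: "integrable (?D \<Otimes>\<^sub>M ?D') (\<lambda>(z, w). g z w)"
    unfolding joint using int by (subst integrable_distr_eq) auto
  have [measurable]: "(\<lambda>z. \<integral>w. g z w \<partial>?D') \<in> borel_measurable borel"
    by measurable
  have [measurable]: "Z \<in> borel_measurable ?F"
    by (rule measurable_vimage_algebra1) auto
  show ?thesis
    unfolding cond_exp_given_def
  proof (rule real_cond_exp_charact)
    show "integrable P (\<lambda>\<omega>. \<integral>w. g (Z \<omega>) w \<partial>?D')"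
      using DD.integrable_fst'[OF intDD] by (subst (asm) integrable_distr_eq) auto
    show "(\<lambda>\<omega>. \<integral>w. g (Z \<omega>) w \<partial>?D') \<in> borel_measurable ?F"
      by measurable
    fix A assume "A \<in> sets ?F"
    then obtain B where B [measurable]: "B \<in> sets borel" and A: "A = Z -` B \<inter> space P"
      by (auto simp: sets_vimage_algebra2)
    have ind_A: "indicator A \<omega> = (indicator B (Z \<omega>) :: real)" if "\<omega> \<in> space P" for \<omega>
      using that by (auto simp: A indicator_def)
    have "integrable (?D \<Otimes>\<^sub>M ?D') (\<lambda>p. indicator (B \<times> UNIV) p *\<^sub>R (case p of (z, w) \<Rightarrow> g z w))"
      by (rule integrable_mult_indicator[OF _ intDD]) auto
    then have intB: "integrable (?D \<Otimes>\<^sub>M ?D') (\<lambda>(z, w). indicator B z * g z w)"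
      by (rule back_subst[where P = "integrable _"]) (auto simp: indicator_def)
    have "(\<integral>\<omega>\<in>A. g (Z \<omega>) (Z' \<omega>) \<partial>P) = (\<integral>\<omega>. (case (Z \<omega>, Z' \<omega>) of (z, w) \<Rightarrow> indicator B z * g z w) \<partial>P)"
      unfolding set_lebesgue_integral_def
      by (rule Bochner_Integration.integral_cong) (auto simp: ind_A)
    also have "\<dots> = (\<integral>p. (case p of (z, w) \<Rightarrow> indicator B z * g z w) \<partial>(?D \<Otimes>\<^sub>M ?D'))"
      unfolding joint by (subst integral_distr) auto
    also have "\<dots> = (\<integral>z. indicator B z * (\<integral>w. g z w \<partial>?D') \<partial>?D)"
      using DD.integral_fst'[OF intB] by simp
    also have "\<dots> = (\<integral>\<omega>. indicator B (Z \<omega>) * (\<integral>w. g (Z \<omega>) w \<partial>?D') \<partial>P)"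
      by (subst integral_distr) auto
    also have "\<dots> = (\<integral>\<omega>\<in>A. (\<integral>w. g (Z \<omega>) w \<partial>?D') \<partial>P)"
      unfolding set_lebesgue_integral_def
      by (rule Bochner_Integration.integral_cong) (auto simp: ind_A)
    finally show "(\<integral>\<omega>\<in>A. g (Z \<omega>) (Z' \<omega>) \<partial>P) = (\<integral>\<omega>\<in>A. (\<integral>w. g (Z \<omega>) w \<partial>?D') \<partial>P)" .
  qed (rule int)
qed

lemma distributed_std_normal:
  assumes "distributed P lborel Z std_normal_density"
  shows "Z \<in> borel_measurable P" "distr P borel Z = std_normal_distribution"
  using assms distributed_distr_eq_density[OF assms]
  by (auto simp: distributed_def cong: distr_cong)

context
  fixes P :: "'b measure" and Z Z' :: "'b \<Rightarrow> real"
  assumes P: "prob_space P"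
    and dZ: "distributed P lborel Z std_normal_density"
    and dZ': "distributed P lborel Z' std_normal_density"
    and ind: "prob_space.indep_var P borel Z borel Z'"
begin

lemma integral_std_normal_compose:
  assumes "f \<in> borel_measurable borel"
  shows "(\<integral>\<omega>. f (Z \<omega>) \<partial>P) = (\<integral>z. f z \<partial>std_normal_distribution :: real)"
  using integral_distr[OF distributed_std_normal(1)[OF dZ] assms] distributed_std_normal(2)[OF dZ] by simp

text \<open>The first part is freezing; the second integrates it, since a conditional expectation
  has the same integral as the function conditioned.\<close>

lemma cond_exp_given_std_normal:
  "AE \<omega> in P. cond_exp_given P Z (\<lambda>\<omega>. \<bar>x * Z \<omega> - y * Z' \<omega>\<bar>) \<omega> = gauss_abs x y (Z \<omega>)"
  "(\<integral>\<omega>. \<bar>x * Z \<omega> - y * Z' \<omega>\<bar> \<partial>P) = (\<integral>z. gauss_abs x y z \<partial>std_normal_distribution)"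
proof -
  interpret prob_space P by (rule P)
  note [measurable] = distributed_std_normal(1)[OF dZ] distributed_std_normal(1)[OF dZ']
  have "integrable P Z" "integrable P Z'"
    using distributed_integrable[OF dZ, of "\<lambda>x. x"] distributed_integrable[OF dZ', of "\<lambda>x. x"]
      integrable_std_normal_moment[of 1] by auto
  then have int: "integrable P (\<lambda>\<omega>. \<bar>x * Z \<omega> - y * Z' \<omega>\<bar>)" by auto
  then show ae: "AE \<omega> in P. cond_exp_given P Z (\<lambda>\<omega>. \<bar>x * Z \<omega> - y * Z' \<omega>\<bar>) \<omega> = gauss_abs x y (Z \<omega>)"
    using cond_exp_given_indep[OF P _ _ ind, of "\<lambda>z w. \<bar>x * z - y * w\<bar>"]
    by (simp add: distributed_std_normal(2)[OF dZ'] gauss_abs_def)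
  let ?F = "vimage_algebra (space P) Z borel"
  have "subalgebra P ?F"
    unfolding subalgebra_def by (auto simp: sets_vimage_algebra2 intro!: measurable_sets)
  then interpret finite_measure_subalgebra P ?F by unfold_locales
  have "(\<integral>\<omega>. \<bar>x * Z \<omega> - y * Z' \<omega>\<bar> \<partial>P) = (\<integral>\<omega>. cond_exp_given P Z (\<lambda>\<omega>. \<bar>x * Z \<omega> - y * Z' \<omega>\<bar>) \<omega> \<partial>P)"
    unfolding cond_exp_given_def using real_cond_exp_int(2)[OF int] by simp
  also have "\<dots> = (\<integral>\<omega>. gauss_abs x y (Z \<omega>) \<partial>P)"
    using ae by (intro integral_cong_AE) (auto simp: cond_exp_given_def)
  also have "\<dots> = (\<integral>z. gauss_abs x y z \<partial>std_normal_distribution)"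
    by (rule integral_std_normal_compose) auto
  finally show "(\<integral>\<omega>. \<bar>x * Z \<omega> - y * Z' \<omega>\<bar> \<partial>P) = (\<integral>z. gauss_abs x y z \<partial>std_normal_distribution)" .
qed

text \<open>The exceptional null set of a conditional expectation depends on the pair (u j, u k).
  For fixed j only finitely many pairs occur, so the null sets unite to one.\<close>

lemma f_fun_eq:
  "f_fun P Z Z' b u = 1 / real b * (\<Sum>j = 1..b. \<integral>z.
      (1 / (real b - 1) * (\<Sum>k\<in>{1..b} - {j}. gauss_abs_centred (u j) (u k) z))\<^sup>2 \<partial>std_normal_distribution)"
  unfolding f_fun_def power2_abs
proof (intro arg_cong[where f = "\<lambda>x. _ * x"] sum.cong refl)
  fix j assume "j \<in> {1..b}"
  note [measurable] = distributed_std_normal(1)[OF dZ] distributed_std_normal(1)[OF dZ']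
  have ae: "AE \<omega> in P. \<forall>k\<in>{1..b} - {j}.
      cond_exp_given P Z (\<lambda>\<omega>. \<bar>u j * Z \<omega> - u k * Z' \<omega>\<bar>) \<omega> = gauss_abs (u j) (u k) (Z \<omega>)"
    by (intro AE_finite_allI cond_exp_given_std_normal) auto
  have "(\<integral>\<omega>. (1 / (real b - 1) * (\<Sum>k\<in>{1..b} - {j}.
          cond_exp_given P Z (\<lambda>\<omega>'. \<bar>u j * Z \<omega>' - u k * Z' \<omega>'\<bar>) \<omega>
          - (\<integral>\<omega>'. \<bar>u j * Z \<omega>' - u k * Z' \<omega>'\<bar> \<partial>P)))\<^sup>2 \<partial>P)
     = (\<integral>\<omega>. (1 / (real b - 1) * (\<Sum>k\<in>{1..b} - {j}. gauss_abs_centred (u j) (u k) (Z \<omega>)))\<^sup>2 \<partial>P)"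
  proof (rule integral_cong_AE)
    show "AE \<omega> in P. (1 / (real b - 1) * (\<Sum>k\<in>{1..b} - {j}.
          cond_exp_given P Z (\<lambda>\<omega>'. \<bar>u j * Z \<omega>' - u k * Z' \<omega>'\<bar>) \<omega>
          - (\<integral>\<omega>'. \<bar>u j * Z \<omega>' - u k * Z' \<omega>'\<bar> \<partial>P)))\<^sup>2
        = (1 / (real b - 1) * (\<Sum>k\<in>{1..b} - {j}. gauss_abs_centred (u j) (u k) (Z \<omega>)))\<^sup>2"
      using ae by eventually_elim (simp add: cond_exp_given_std_normal(2) gauss_abs_centred_def)
  qed (auto simp: cond_exp_given_def)
  also have "\<dots> = (\<integral>z. (1 / (real b - 1) * (\<Sum>k\<in>{1..b} - {j}. gauss_abs_centred (u j) (u k) z))\<^sup>2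
      \<partial>std_normal_distribution)"
    by (rule integral_std_normal_compose) auto
  finally show "(\<integral>\<omega>. (1 / (real b - 1) * (\<Sum>k\<in>{1..b} - {j}.
          cond_exp_given P Z (\<lambda>\<omega>'. \<bar>u j * Z \<omega>' - u k * Z' \<omega>'\<bar>) \<omega>
          - (\<integral>\<omega>'. \<bar>u j * Z \<omega>' - u k * Z' \<omega>'\<bar> \<partial>P)))\<^sup>2 \<partial>P)
     = (\<integral>z. (1 / (real b - 1) * (\<Sum>k\<in>{1..b} - {j}. gauss_abs_centred (u j) (u k) z))\<^sup>2
      \<partial>std_normal_distribution)" .
qed

text \<open>Here uncountably many pairs occur and the null sets cannot be united. Instead "for a.e.
  y, a.s." is exchanged with "a.s., for a.e. y" by Fubini, for which the joint measurability of
  \<open>G\<close> is essential. Replacing \<sigma> by a Borel function \<tau> on the whole line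
  makes the composition with \<open>G\<close> measurable.\<close>

lemma psi_sq_eq:
  assumes G: "cond_abs_version P Z Z' G" and [measurable]: "\<tau> \<in> borel_measurable borel"
    and \<tau>: "\<And>x. x \<in> {0..1} \<Longrightarrow> \<sigma> x = \<tau> x"
  shows "psi_sq P Z Z' G \<sigma> = 4 * (LBINT x:{0..1}. \<integral>z.
      (LBINT y:{0..1}. gauss_abs_centred (\<tau> x) (\<tau> y) z)\<^sup>2 \<partial>std_normal_distribution)"
proof -
  interpret prob_space P by (rule P)
  interpret PL: pair_sigma_finite P "lborel :: real measure" ..
  note [measurable] = distributed_std_normal(1)[OF dZ] distributed_std_normal(1)[OF dZ']
  let ?F = "vimage_algebra (space P) Z borel"
  \<comment> \<open>\<open>G\<close> is measurable with respect to the sigma-field of Z; the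
    identity carries this over to the finer sigma-field of \<open>P\<close>.\<close>
  have id_meas: "(\<lambda>\<omega>. \<omega>) \<in> measurable P ?F"
    by (rule measurable_vimage_algebra2) auto
  have G_meas [measurable]: "(\<lambda>(\<omega>, y). G a (\<tau> y) \<omega>) \<in> borel_measurable (P \<Otimes>\<^sub>M lborel)" for a
  proof -
    have "(\<lambda>(\<omega>, y). (a, \<tau> y, \<omega>)) \<in> measurable (P \<Otimes>\<^sub>M lborel) (borel \<Otimes>\<^sub>M borel \<Otimes>\<^sub>M ?F)"
      unfolding case_prod_beta
      by (intro measurable_Pair measurable_const measurable_compose[OF measurable_fst id_meas]) auto
    from measurable_compose[OF this, of "\<lambda>(x, y, \<omega>). G x y \<omega>" borel] show ?thesis
      using G by (simp add: cond_abs_version_def case_prod_beta)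
  qed
  have inner: "(\<integral>\<omega>. (LBINT y:{0..1}. G a (\<tau> y) \<omega> - (\<integral>\<omega>'. \<bar>a * Z \<omega>' - \<tau> y * Z' \<omega>'\<bar> \<partial>P))\<^sup>2 \<partial>P)
      = (\<integral>z. (LBINT y:{0..1}. gauss_abs_centred a (\<tau> y) z)\<^sup>2 \<partial>std_normal_distribution)" for a
  proof -
    have "AE \<omega> in P. G a c \<omega> = gauss_abs a c (Z \<omega>)" for c
    proof -
      have "AE \<omega> in P. G a c \<omega> = cond_exp_given P Z (\<lambda>\<omega>. \<bar>a * Z \<omega> - c * Z' \<omega>\<bar>) \<omega>"
        using G by (simp add: cond_abs_version_def)
      with cond_exp_given_std_normal(1)[of a c] show ?thesis by eventually_elim simp
    qed
    then have "AE y in lborel. AE \<omega> in P. G a (\<tau> y) \<omega> = gauss_abs a (\<tau> y) (Z \<omega>)"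
      by simp
    then have "AE \<omega> in P. AE y in lborel. G a (\<tau> y) \<omega> = gauss_abs a (\<tau> y) (Z \<omega>)"
      by (subst PL.AE_commute) measurable
    then have ae: "AE \<omega> in P. (LBINT y:{0..1}. G a (\<tau> y) \<omega> - (\<integral>\<omega>'. \<bar>a * Z \<omega>' - \<tau> y * Z' \<omega>'\<bar> \<partial>P))
        = (LBINT y:{0..1}. gauss_abs_centred a (\<tau> y) (Z \<omega>))"
    proof (rule AE_mp, intro AE_I2 impI)
      fix \<omega> assume [measurable]: "\<omega> \<in> space P"
        and "AE y in lborel. G a (\<tau> y) \<omega> = gauss_abs a (\<tau> y) (Z \<omega>)"
      moreover have "(\<lambda>y. G a (\<tau> y) \<omega>) \<in> borel_measurable borel"
        using measurable_Pair2[OF G_meas[of a] \<open>\<omega> \<in> space P\<close>] by simp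
      ultimately show "(LBINT y:{0..1}. G a (\<tau> y) \<omega> - (\<integral>\<omega>'. \<bar>a * Z \<omega>' - \<tau> y * Z' \<omega>'\<bar> \<partial>P))
          = (LBINT y:{0..1}. gauss_abs_centred a (\<tau> y) (Z \<omega>))"
        unfolding cond_exp_given_std_normal(2)
        by (intro set_lebesgue_integral_cong_AE) (auto simp: gauss_abs_centred_def)
    qed
    have "(\<integral>\<omega>. (LBINT y:{0..1}. G a (\<tau> y) \<omega> - (\<integral>\<omega>'. \<bar>a * Z \<omega>' - \<tau> y * Z' \<omega>'\<bar> \<partial>P))\<^sup>2 \<partial>P)
        = (\<integral>\<omega>. (LBINT y:{0..1}. gauss_abs_centred a (\<tau> y) (Z \<omega>))\<^sup>2 \<partial>P)"
    proof (rule integral_cong_AE)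
      show "AE \<omega> in P. (LBINT y:{0..1}. G a (\<tau> y) \<omega> - (\<integral>\<omega>'. \<bar>a * Z \<omega>' - \<tau> y * Z' \<omega>'\<bar> \<partial>P))\<^sup>2
        = (LBINT y:{0..1}. gauss_abs_centred a (\<tau> y) (Z \<omega>))\<^sup>2"
        using ae by eventually_elim simp
      show "(\<lambda>\<omega>. (LBINT y:{0..1}. G a (\<tau> y) \<omega> - (\<integral>\<omega>'. \<bar>a * Z \<omega>' - \<tau> y * Z' \<omega>'\<bar> \<partial>P))\<^sup>2) \<in> borel_measurable P"
        unfolding cond_exp_given_std_normal(2) set_lebesgue_integral_def by measurable
    qed (unfold set_lebesgue_integral_def, measurable)
    also have "\<dots> = (\<integral>z. (LBINT y:{0..1}. gauss_abs_centred a (\<tau> y) z)\<^sup>2 \<partial>std_normal_distribution)"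
      by (rule integral_std_normal_compose) (unfold set_lebesgue_integral_def, measurable)
    finally show ?thesis .
  qed
  have "(LBINT y:{0..1}. G (\<sigma> x) (\<sigma> y) \<omega> - (\<integral>\<omega>'. \<bar>\<sigma> x * Z \<omega>' - \<sigma> y * Z' \<omega>'\<bar> \<partial>P))
      = (LBINT y:{0..1}. G (\<tau> x) (\<tau> y) \<omega> - (\<integral>\<omega>'. \<bar>\<tau> x * Z \<omega>' - \<tau> y * Z' \<omega>'\<bar> \<partial>P))"
    if "x \<in> {0..1}" for x \<omega>
    using that \<tau> by (intro set_lebesgue_integral_cong) auto
  then show ?thesis
    unfolding psi_sq_def power2_abs inner[symmetric]
    by (intro arg_cong[where f = "\<lambda>x. _ * x"] set_lebesgue_integral_cong) auto
qed

end

section \<open>Blocks of the unit interval\<close>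

text \<open>Half-open, because the intervals [(j-1)/b, j/b) partition [0,1), while x = 1 would fall
  into a block b + 1. As a probability measure it admits the moment inequalities proved for
  \<open>prob_space\<close>.\<close>

abbreviation unif01 :: "real measure" where
  "unif01 \<equiv> density lborel (\<lambda>x. ennreal (indicator {0..<1} x))"

interpretation unif01: prob_space unif01
proof
  have "emeasure unif01 (space unif01) = emeasure lborel {0..<1::real}"
    by (subst emeasure_density) (auto simp: ennreal_indicator)
  then show "emeasure unif01 (space unif01) = 1" by simp
qed

lemma unif01_prob_UNIV: "unif01.prob UNIV = 1"
  using unif01.prob_space by simp

lemma AE_unif01: "AE x in unif01. x \<in> {0..<1}"
  by (subst AE_density) (auto simp: indicator_def)

lemma integral_unif01:
  fixes f :: "real \<Rightarrow> real"
  assumes [measurable]: "f \<in> borel_measurable borel"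
  shows "(\<integral>x. f x \<partial>unif01) = (LBINT x:{0..1}. f x)"
proof -
  have "(\<integral>x. f x \<partial>unif01) = (\<integral>x. indicator {0..<1} x *\<^sub>R f x \<partial>lborel)"
    by (rule integral_density) auto
  also have "\<dots> = (\<integral>x. indicator {0..1} x *\<^sub>R f x \<partial>lborel)"
  proof (rule integral_cong_AE)
    have "AE x in lborel. x \<noteq> (1::real)" by (rule AE_lborel_singleton)
    then show "AE x in lborel. indicator {0..<1} x *\<^sub>R f x = indicator {0..1} x *\<^sub>R f x"
      by eventually_elim (auto simp: indicator_def)
  qed auto
  finally show ?thesis by (simp add: set_lebesgue_integral_def)
qed

text \<open>Blocks are numbered from 1, hence the \<open>+ 1\<close>; the floor makes measurability
  immediate.\<close>

definition block_index :: "nat \<Rightarrow> real \<Rightarrow> nat" where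
  "block_index b x = nat \<lfloor>real b * x\<rfloor> + 1"

lemma block_index_measurable [measurable]: "block_index b \<in> measurable borel (count_space UNIV)"
  unfolding block_index_def by measurable

lemma block_index_eq_iff:
  assumes "1 \<le> b" "0 \<le> x" "1 \<le> j"
  shows "block_index b x = j \<longleftrightarrow> (real j - 1) / real b \<le> x \<and> x < real j / real b"
proof -
  have "block_index b x = j \<longleftrightarrow> \<lfloor>real b * x\<rfloor> = int j - 1"
    using assms by (auto simp: block_index_def nat_eq_iff)
  also have "\<dots> \<longleftrightarrow> real j - 1 \<le> real b * x \<and> real b * x < real j"
    by (simp add: floor_eq_iff)
  also have "\<dots> \<longleftrightarrow> (real j - 1) / real b \<le> x \<and> x < real j / real b"
    using assms by (simp add: field_simps)
  finally show ?thesis .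
qed

lemma block_index_range:
  assumes "1 \<le> b" "x \<in> {0..<1}"
  shows "block_index b x \<in> {1..b}"
proof -
  have "real b * x < real b" using assms by simp
  moreover have "0 \<le> real b * x" using assms by simp
  ultimately have "\<lfloor>real b * x\<rfloor> < int b" "0 \<le> \<lfloor>real b * x\<rfloor>"
    by (auto simp: floor_less_iff)
  then show ?thesis by (simp add: block_index_def Suc_le_eq nat_less_iff)
qed

text \<open>The bridge from averages over blocks to integrals: almost everywhere the step function
  is the sum of \<open>\<phi> j\<close> times the indicator of the j-th interval, and each interval
  has mass 1/b.\<close>

lemma unif01_block_index:
  fixes \<phi> :: "nat \<Rightarrow> real"
  assumes "1 \<le> b"
  shows "integrable unif01 (\<lambda>x. \<phi> (block_index b x))"
    and "(\<integral>x. \<phi> (block_index b x) \<partial>unif01) = 1 / real b * (\<Sum>j = 1..b. \<phi> j)"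
proof -
  let ?I = "\<lambda>j::nat. {(real j - 1) / real b..<real j / real b}"
  let ?s = "\<lambda>x. \<Sum>j = 1..b. \<phi> j * indicator (?I j) x"
  have meas: "(\<lambda>x. \<phi> (block_index b x)) \<in> borel_measurable unif01"
    by measurable
  have ae: "AE x in unif01. ?s x = \<phi> (block_index b x)"
    using AE_unif01
  proof eventually_elim
    case (elim x)
    have "?s x = (\<Sum>j = 1..b. if j = block_index b x then \<phi> j else 0)"
      using block_index_eq_iff[OF assms, of x] elim by (intro sum.cong refl) (auto simp: indicator_def)
    also have "\<dots> = \<phi> (block_index b x)"
      using block_index_range[OF assms elim] by simp
    finally show ?case .
  qed
  have int1: "integrable unif01 (\<lambda>x. \<phi> j * indicator (?I j) x)" for j
    by (intro integrable_mult_right unif01.integrable_const_bound[of _ 1]) (auto simp: indicator_def)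
  then have int: "integrable unif01 ?s"
    by (intro Bochner_Integration.integrable_sum)
  show "integrable unif01 (\<lambda>x. \<phi> (block_index b x))"
    using integrable_cong_AE[OF borel_measurable_integrable[OF int] meas ae] int by (simp only:)
  have "(\<integral>x. \<phi> (block_index b x) \<partial>unif01) = (\<integral>x. ?s x \<partial>unif01)"
    using integral_cong_AE[OF borel_measurable_integrable[OF int] meas ae] by (rule sym)
  also have "\<dots> = (\<Sum>j = 1..b. \<phi> j * unif01.prob (?I j))"
    by (subst Bochner_Integration.integral_sum[OF int1]) simp
  also have "\<dots> = (\<Sum>j = 1..b. \<phi> j * (1 / real b))"
  proof (intro sum.cong refl arg_cong[where f = "\<lambda>x. _ * x"])
    fix j assume j: "j \<in> {1..b}"
    have sub: "?I j \<subseteq> {0..<1}"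
    proof
      fix x assume x: "x \<in> ?I j"
      have "0 \<le> (real j - 1) / real b" "real j / real b \<le> 1" using j assms by auto
      with x show "x \<in> {0..<1}" by auto
    qed
    have "emeasure unif01 (?I j) = emeasure lborel (?I j)"
    proof -
      have "emeasure unif01 (?I j) = (\<integral>\<^sup>+x. indicator {0..<1} x * indicator (?I j) x \<partial>lborel)"
        by (subst emeasure_density) (auto simp: ennreal_indicator)
      also have "\<dots> = (\<integral>\<^sup>+x. indicator (?I j) x \<partial>lborel)"
        using sub by (intro nn_integral_cong) (auto simp: indicator_def)
      finally show ?thesis by simp
    qed
    then have "unif01.prob (?I j) = measure lborel (?I j)"
      by (simp add: measure_def)
    also have "\<dots> = 1 / real b"
      using assms by (simp add: divide_right_mono diff_divide_distrib)
    finally show "unif01.prob (?I j) = 1 / real b" .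
  qed
  finally show "(\<integral>x. \<phi> (block_index b x) \<partial>unif01) = 1 / real b * (\<Sum>j = 1..b. \<phi> j)"
    by (simp add: sum_distrib_left mult.commute)
qed

section \<open>Stability of the quadratic functional\<close>

text \<open>From a^2 - c^2 = (a - c) ((a - c) + 2 c): only c needs an a priori bound. In the
  application c is built from the bounded scale function, while a is built from local standard
  deviations, for which no uniform bound is available.\<close>

lemma abs_square_diff_le:
  fixes a c q r S :: real
  assumes "\<bar>a - c\<bar> \<le> 4 * r * q" "\<bar>c\<bar> \<le> 2 * S * r" "0 \<le> r" "0 \<le> q"
  shows "\<bar>a\<^sup>2 - c\<^sup>2\<bar> \<le> r\<^sup>2 * (16 * q\<^sup>2 + 16 * S * q)"
proof -
  have "\<bar>a\<^sup>2 - c\<^sup>2\<bar> = \<bar>a - c\<bar> * \<bar>(a - c) + 2 * c\<bar>"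
    by (simp add: power2_eq_square abs_mult[symmetric] algebra_simps)
  also have "\<dots> \<le> (4 * r * q) * (4 * r * q + 2 * (2 * S * r))"
    using assms by (intro mult_mono) auto
  also have "\<dots> = r\<^sup>2 * (16 * q\<^sup>2 + 16 * S * q)"
    by (simp add: power2_eq_square algebra_simps)
  finally show ?thesis .
qed

text \<open>\<open>D\<close> is the squared L^2 distance of the step function from \<tau>, and
  \<open>e\<close> is the price of the omitted diagonal. With the pointwise error \<open>q\<close>
  below, \<open>abs_square_diff_le\<close> leaves 16 E q^2 + 16 S E q. Then E q^2 \<le> 3 (2 D +
  e^2) produces 96 and 48, and E q \<le> 2 sqrt D + e produces the last term.\<close>

lemma gauss_functional_diff:
  fixes u :: "nat \<Rightarrow> real" and \<tau> :: "real \<Rightarrow> real"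
  assumes b: "2 \<le> b" and [measurable]: "\<tau> \<in> borel_measurable borel" and \<tau>: "\<And>x. \<bar>\<tau> x\<bar> \<le> S"
  defines "D \<equiv> (\<integral>x. (u (block_index b x) - \<tau> x)\<^sup>2 \<partial>unif01)"
    and "e \<equiv> S / (real b - 1)"
  shows "\<bar>1 / real b * (\<Sum>j = 1..b. \<integral>z.
            (1 / (real b - 1) * (\<Sum>k\<in>{1..b} - {j}. gauss_abs_centred (u j) (u k) z))\<^sup>2 \<partial>std_normal_distribution)
        - (\<integral>x. \<integral>z. (\<integral>y. gauss_abs_centred (\<tau> x) (\<tau> y) z \<partial>unif01)\<^sup>2 \<partial>std_normal_distribution \<partial>unif01)\<bar>
      \<le> (\<integral>z. (2 * (\<bar>z\<bar> + 1))\<^sup>2 \<partial>std_normal_distribution) * (96 * D + 48 * e\<^sup>2 + 16 * S * (2 * sqrt D + e))"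
proof -
  let ?N = std_normal_distribution
  let ?h = gauss_abs_centred
  define r where "r = (\<lambda>z::real. 2 * (\<bar>z\<bar> + 1))"
  define v where "v = (\<lambda>x. u (block_index b x))"
  define A where "A = (\<lambda>j z. 1 / (real b - 1) * (\<Sum>k\<in>{1..b} - {j}. ?h (u j) (u k) z))"
  define A' where "A' = (\<lambda>x z. \<integral>y. ?h (\<tau> x) (\<tau> y) z \<partial>unif01)"
  define d where "d = (\<lambda>x. \<bar>v x - \<tau> x\<bar>)"
  define dbar where "dbar = (\<integral>x. d x \<partial>unif01)"
  \<comment> \<open>The three errors: in the first argument of the kernel, in the second argument
    averaged over y, and from the missing diagonal.\<close>
  define q where "q = (\<lambda>x. d x + dbar + e)"
  have b1: "1 \<le> b" "real b - 1 \<ge> 1" using b by auto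
  have S0: "0 \<le> S" using \<tau>[of 0] by linarith
  have e0: "0 \<le> e" using S0 b1 by (simp add: e_def)
  have r0: "0 \<le> r z" for z by (simp add: r_def)
  have h_diff: "\<bar>?h x y z - ?h x' y' z\<bar> \<le> r z * (\<bar>x - x'\<bar> + \<bar>y - y'\<bar>)" for x y x' y' z
    using gauss_abs_centred_diff by (simp add: r_def)
  have h_bound: "\<bar>?h x y z\<bar> \<le> r z * (\<bar>x\<bar> + \<bar>y\<bar>)" for x y z
    using gauss_abs_centred_bound by (simp add: r_def)
  have v_meas [measurable]: "v \<in> borel_measurable borel" unfolding v_def by measurable
  have step_int: "integrable unif01 (\<lambda>x. f (v x))" for f :: "real \<Rightarrow> real"
    using unif01_block_index(1)[OF b1(1), of "\<lambda>j. f (u j)"] by (simp add: v_def)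
  have d_meas [measurable]: "d \<in> borel_measurable borel" unfolding d_def by measurable
  have d2_int: "integrable unif01 (\<lambda>x. (d x)\<^sup>2)"
  proof (rule unif01.expectation_dominated(1))
    show "integrable unif01 (\<lambda>x. 2 * (v x)\<^sup>2 + 2 * S\<^sup>2)"
      using step_int[of "\<lambda>t. t\<^sup>2"] by simp
    show "\<bar>(d x)\<^sup>2\<bar> \<le> 2 * (v x)\<^sup>2 + 2 * S\<^sup>2" for x
    proof -
      have "(d x)\<^sup>2 \<le> 2 * (v x)\<^sup>2 + 2 * (\<tau> x)\<^sup>2"
        using sum_squares_bound[of "v x" "- \<tau> x"] by (simp add: d_def power2_eq_square algebra_simps)
      moreover have "(\<tau> x)\<^sup>2 \<le> S\<^sup>2" using \<tau>[of x] by (rule abs_le_square_iff[THEN iffD1, OF order_trans]) simp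
      ultimately show ?thesis by simp
    qed
  qed simp
  have d_int: "integrable unif01 d"
    by (rule unif01.expectation_abs_le_sqrt(1)[OF _ d2_int]) simp
  have D: "D = (\<integral>x. (d x)\<^sup>2 \<partial>unif01)" by (simp add: D_def d_def v_def)
  have d0: "0 \<le> d x" for x by (simp add: d_def)
  have dbar0: "0 \<le> dbar" unfolding dbar_def using d0 by simp
  have dbar_le: "dbar \<le> sqrt D"
    using unif01.expectation_abs_le_sqrt(2)[OF _ d2_int] d0 by (simp add: dbar_def D)
  have D0: "0 \<le> D" unfolding D by simp
  have dbar2: "dbar\<^sup>2 \<le> D"
    using dbar_le dbar0 D0 by (metis power_mono real_sqrt_pow2)
  have q0: "0 \<le> q x" for x using d0 dbar0 e0 by (simp add: q_def)
  have q_int: "integrable unif01 q" "(\<integral>x. q x \<partial>unif01) = 2 * dbar + e"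
    using d_int unfolding q_def by (auto simp: dbar_def unif01_prob_UNIV)
  have q2_le: "(q x)\<^sup>2 \<le> 3 * ((d x)\<^sup>2 + dbar\<^sup>2 + e\<^sup>2)" for x
  proof -
    have "0 \<le> (d x - dbar)\<^sup>2 + (d x - e)\<^sup>2 + (dbar - e)\<^sup>2" by simp
    then show ?thesis by (simp add: q_def power2_eq_square algebra_simps)
  qed
  have q2_dom: "integrable unif01 (\<lambda>x. 3 * ((d x)\<^sup>2 + dbar\<^sup>2 + e\<^sup>2))"
    using d2_int by simp
  have q2_int: "integrable unif01 (\<lambda>x. (q x)\<^sup>2)"
    by (rule unif01.expectation_dominated(1)[OF _ q2_dom]) (use q2_le in \<open>auto simp: q_def\<close>)
  have q2_E: "(\<integral>x. (q x)\<^sup>2 \<partial>unif01) \<le> 3 * (2 * D + e\<^sup>2)"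
  proof -
    have "(\<integral>x. (q x)\<^sup>2 \<partial>unif01) \<le> (\<integral>x. 3 * ((d x)\<^sup>2 + dbar\<^sup>2 + e\<^sup>2) \<partial>unif01)"
      by (rule integral_mono[OF q2_int q2_dom q2_le])
    also have "\<dots> = 3 * (D + dbar\<^sup>2 + e\<^sup>2)"
      using d2_int by (simp add: D unif01_prob_UNIV)
    finally show ?thesis using dbar2 by simp
  qed
  have h\<tau>_int: "integrable unif01 (\<lambda>y. ?h x (\<tau> y) z)" for x z
  proof (rule unif01.integrable_const_bound[of _ "r z * (\<bar>x\<bar> + S)"])
    show "AE y in unif01. norm (?h x (\<tau> y) z) \<le> r z * (\<bar>x\<bar> + S)"
      using \<tau> r0 by (intro AE_I2) (auto intro!: order_trans[OF h_bound] mult_left_mono)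
  qed measurable
  have A'_bound: "\<bar>A' x z\<bar> \<le> 2 * S * r z" for x z
  proof -
    have "\<bar>A' x z\<bar> \<le> (\<integral>y. 2 * S * r z \<partial>unif01)"
      unfolding A'_def
    proof (rule unif01.expectation_dominated(3))
      fix y
      have "\<bar>?h (\<tau> x) (\<tau> y) z\<bar> \<le> r z * (\<bar>\<tau> x\<bar> + \<bar>\<tau> y\<bar>)" by (rule h_bound)
      also have "\<dots> \<le> r z * (S + S)" using \<tau> r0 by (intro mult_left_mono add_mono) auto
      finally show "\<bar>?h (\<tau> x) (\<tau> y) z\<bar> \<le> 2 * S * r z" by (simp add: algebra_simps)
    qed auto
    then show ?thesis by (simp add: unif01_prob_UNIV)
  qed
  have A_diff: "\<bar>A (block_index b x) z - A' x z\<bar> \<le> 4 * r z * q x" if x: "x \<in> {0..<1}" for x z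
  proof -
    define j where "j = block_index b x"
    have j: "j \<in> {1..b}" unfolding j_def by (rule block_index_range[OF b1(1) x])
    define m where "m = (\<integral>y. \<bar>v y\<bar> \<partial>unif01)"
    \<comment> \<open>The intermediate quantity is the full average, diagonal included. It differs
      from \<open>A j\<close> by (a - h) / (b - 1), where h is the diagonal term, and from
      \<open>A'\<close> by the Lipschitz bound.\<close>
    define a where "a = (\<integral>y. ?h (v x) (v y) z \<partial>unif01)"
    have vx: "\<bar>v x\<bar> \<le> d x + S" using \<tau>[of x] by (simp add: d_def)
    have m: "m \<le> dbar + S"
    proof -
      have "m \<le> (\<integral>y. d y + S \<partial>unif01)"
        unfolding m_def
      proof (rule integral_mono)
        show "\<bar>v y\<bar> \<le> d y + S" for y using \<tau>[of y] by (simp add: d_def)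
      qed (use step_int[of abs] d_int in auto)
      then show ?thesis using d_int by (simp add: dbar_def unif01_prob_UNIV)
    qed
    have "(\<Sum>k = 1..b. ?h (u j) (u k) z) = real b * a"
      using unif01_block_index(2)[OF b1(1), of "\<lambda>k. ?h (u j) (u k) z"] b1
      by (simp add: a_def v_def j_def)
    then have "A j z = 1 / (real b - 1) * (real b * a - ?h (u j) (u j) z)"
      using j by (simp add: A_def sum_diff1)
    then have Aa: "A j z - a = 1 / (real b - 1) * (a - ?h (v x) (v x) z)"
      using b1 by (simp add: v_def j_def field_simps)
    have a_bound: "\<bar>a\<bar> \<le> r z * (\<bar>v x\<bar> + m)"
    proof -
      have "\<bar>a\<bar> \<le> (\<integral>y. r z * (\<bar>v x\<bar> + \<bar>v y\<bar>) \<partial>unif01)"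
        unfolding a_def by (rule unif01.expectation_dominated(3))
          (use step_int[of abs] h_bound in auto)
      also have "\<dots> = r z * (\<bar>v x\<bar> + m)"
        using step_int[of abs] by (simp add: m_def unif01_prob_UNIV)
      finally show ?thesis .
    qed
    have "\<bar>a - A' x z\<bar> = \<bar>\<integral>y. ?h (v x) (v y) z - ?h (\<tau> x) (\<tau> y) z \<partial>unif01\<bar>"
      unfolding a_def A'_def using step_int[of "\<lambda>t. ?h (v x) t z"] h\<tau>_int by simp
    also have "\<dots> \<le> (\<integral>y. r z * (d x + d y) \<partial>unif01)"
      by (rule unif01.expectation_dominated(3))
         (use d_int h_diff in \<open>auto simp: d_def\<close>)
    also have "\<dots> = r z * (d x + dbar)"
      using d_int by (simp add: dbar_def unif01_prob_UNIV)
    finally have aA': "\<bar>a - A' x z\<bar> \<le> r z * (d x + dbar)" .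
    have "\<bar>A j z - a\<bar> = 1 / (real b - 1) * \<bar>a - ?h (v x) (v x) z\<bar>"
      unfolding Aa abs_mult using b1 by simp
    \<comment> \<open>One |v x| and m come from a, two more |v x| from the diagonal term.\<close>
    also have "\<dots> \<le> 1 / (real b - 1) * (r z * (3 * \<bar>v x\<bar> + m))"
      using a_bound h_bound[of "v x" "v x" z] b1
      by (intro mult_left_mono) (auto simp: algebra_simps)
    also have "\<dots> \<le> 1 / (real b - 1) * (r z * (3 * (d x + S) + (dbar + S)))"
      using vx m b1 r0 by (intro mult_left_mono add_mono) auto
    also have "\<dots> = r z * (1 / (real b - 1) * (3 * d x + dbar) + 4 * e)"
    proof -
      have "c * (r z * (3 * (d x + S) + (dbar + S))) = r z * (c * (3 * d x + dbar) + 4 * (S * c))" for c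
        by (simp add: algebra_simps)
      from this[of "1 / (real b - 1)"] show ?thesis by (simp add: e_def)
    qed
    \<comment> \<open>The factor 1 / (b - 1) is spent on the terms with S, where it forms 4 e; on
      the distance terms it is just bounded by 1.\<close>
    also have "\<dots> \<le> r z * ((3 * d x + dbar) + 4 * e)"
      using b1 d0[of x] dbar0 r0 by (intro mult_left_mono add_mono mult_left_le_one_le) auto
    finally have "\<bar>A j z - a\<bar> \<le> r z * ((3 * d x + dbar) + 4 * e)" .
    with aA' have "\<bar>A j z - A' x z\<bar> \<le> r z * (d x + dbar) + r z * ((3 * d x + dbar) + 4 * e)"
      by linarith
    also have "\<dots> = r z * (4 * d x + 2 * dbar + 4 * e)" by (simp add: algebra_simps)
    also have "\<dots> \<le> r z * (4 * q x)"
      using dbar0 r0 by (intro mult_left_mono) (auto simp: q_def)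
    finally show ?thesis by (simp add: j_def algebra_simps)
  qed
  have r2_int: "integrable ?N (\<lambda>z. (r z)\<^sup>2)"
    unfolding r_def by (rule integrable_gauss_weight)
  have A_meas: "(\<lambda>z. A j z) \<in> borel_measurable borel" for j
    unfolding A_def by measurable
  have A2_int: "integrable ?N (\<lambda>z. (A j z)\<^sup>2)" for j
  proof -
    define c where "c = 1 / (real b - 1) * (\<Sum>k\<in>{1..b} - {j}. \<bar>u j\<bar> + \<bar>u k\<bar>)"
    have "\<bar>A j z\<bar> \<le> c * r z" for z
    proof -
      have "\<bar>A j z\<bar> \<le> 1 / (real b - 1) * (\<Sum>k\<in>{1..b} - {j}. r z * (\<bar>u j\<bar> + \<bar>u k\<bar>))"
        unfolding A_def abs_mult using b1
        by (intro mult_mono order_trans[OF sum_abs] sum_mono h_bound) auto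
      then show ?thesis
        unfolding c_def sum_distrib_left[symmetric] by (simp only: mult.assoc mult.left_commute mult.commute)
    qed
    then have bnd: "(A j z)\<^sup>2 \<le> c\<^sup>2 * (r z)\<^sup>2" for z
      by (metis abs_ge_zero power2_abs power_mono power_mult_distrib)
    show ?thesis
      by (rule std_normal.expectation_dominated(1)[OF _ integrable_mult_right[OF r2_int, of "c\<^sup>2"]])
         (use bnd A_meas in auto)
  qed
  have A'_meas: "(\<lambda>(x, z). A' x z) \<in> borel_measurable (borel \<Otimes>\<^sub>M borel)"
    unfolding A'_def by measurable
  have A'_meas1: "(\<lambda>z. A' x z) \<in> borel_measurable borel" for x
    using A'_meas by measurable
  have A'2_bnd: "(A' x z)\<^sup>2 \<le> (2 * S)\<^sup>2 * (r z)\<^sup>2" for x z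
    using A'_bound[of x z] by (metis abs_ge_zero power2_abs power_mono power_mult_distrib)
  have A'2_int: "integrable ?N (\<lambda>z. (A' x z)\<^sup>2)" for x
    by (rule std_normal.expectation_dominated(1)[OF _ integrable_mult_right[OF r2_int, of "(2 * S)\<^sup>2"]])
       (use A'2_bnd A'_meas1 in auto)
  define \<rho> where "\<rho> = (\<integral>z. (r z)\<^sup>2 \<partial>?N)"
  have \<rho>0: "0 \<le> \<rho>" unfolding \<rho>_def by simp
  define I where "I = (\<lambda>j. \<integral>z. (A j z)\<^sup>2 \<partial>?N)"
  define I' where "I' = (\<lambda>x. \<integral>z. (A' x z)\<^sup>2 \<partial>?N)"
  have I'_meas [measurable]: "I' \<in> borel_measurable borel"
    unfolding I'_def using A'_meas by (intro std_normal.borel_measurable_lebesgue_integral) auto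
  have I'_int: "integrable unif01 I'"
  proof (rule unif01.integrable_const_bound[of _ "(2 * S)\<^sup>2 * \<rho>"])
    have "I' x \<le> (2 * S)\<^sup>2 * \<rho>" for x
      unfolding I'_def \<rho>_def
      by (subst integral_mult_right_zero[symmetric], rule integral_mono[OF A'2_int])
         (use A'2_bnd r2_int in auto)
    moreover have "0 \<le> I' x" for x unfolding I'_def by simp
    ultimately show "AE x in unif01. norm (I' x) \<le> (2 * S)\<^sup>2 * \<rho>" by simp
  qed simp
  have I_diff: "\<bar>I (block_index b x) - I' x\<bar> \<le> \<rho> * (16 * (q x)\<^sup>2 + 16 * S * q x)" if x: "x \<in> {0..<1}" for x
  proof -
    have "I (block_index b x) - I' x = (\<integral>z. (A (block_index b x) z)\<^sup>2 - (A' x z)\<^sup>2 \<partial>?N)"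
      unfolding I_def I'_def by (rule Bochner_Integration.integral_diff[OF A2_int A'2_int, symmetric])
    also have "\<bar>\<dots>\<bar> \<le> (\<integral>z. (r z)\<^sup>2 * (16 * (q x)\<^sup>2 + 16 * S * q x) \<partial>?N)"
    proof (rule std_normal.expectation_dominated(3))
      show "\<bar>(A (block_index b x) z)\<^sup>2 - (A' x z)\<^sup>2\<bar> \<le> (r z)\<^sup>2 * (16 * (q x)\<^sup>2 + 16 * S * q x)" for z
        by (rule abs_square_diff_le[OF A_diff[OF x] A'_bound r0 q0])
    qed (use r2_int A_meas A'_meas1 in auto)
    finally show ?thesis by (simp add: \<rho>_def)
  qed
  have Q_int: "integrable unif01 (\<lambda>x. \<rho> * (16 * (q x)\<^sup>2 + 16 * S * q x))"
    using q2_int q_int(1) by simp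
  have "1 / real b * (\<Sum>j = 1..b. I j) - (\<integral>x. I' x \<partial>unif01)
      = (\<integral>x. I (block_index b x) - I' x \<partial>unif01)"
    using unif01_block_index[OF b1(1), of I] I'_int by simp
  also have "\<bar>\<dots>\<bar> \<le> (\<integral>x. \<bar>I (block_index b x) - I' x\<bar> \<partial>unif01)"
    by (rule integral_abs_bound)
  also have "\<dots> \<le> (\<integral>x. \<rho> * (16 * (q x)\<^sup>2 + 16 * S * q x) \<partial>unif01)"
  proof (rule integral_mono_AE)
    show "AE x in unif01. \<bar>I (block_index b x) - I' x\<bar> \<le> \<rho> * (16 * (q x)\<^sup>2 + 16 * S * q x)"
      using AE_unif01 by eventually_elim (rule I_diff)
  qed (use Q_int unif01_block_index(1)[OF b1(1), of I] I'_int in auto)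
  also have "\<dots> = \<rho> * (16 * (\<integral>x. (q x)\<^sup>2 \<partial>unif01) + 16 * S * (2 * dbar + e))"
    using q2_int q_int by simp
  also have "\<dots> \<le> \<rho> * (16 * (3 * (2 * D + e\<^sup>2)) + 16 * S * (2 * sqrt D + e))"
    using q2_E dbar_le S0 \<rho>0 by (intro mult_left_mono add_mono) auto
  finally show ?thesis
    by (simp add: I_def I'_def A_def A'_def \<rho>_def r_def algebra_simps)
qed

section \<open>Scale functions and local variances\<close>

text \<open>On [0,1] the value of h depends only on the position of x relative to J, and a finite J
  allows only finitely many positions.\<close>

lemma piecewise_constant01_finite_range:
  assumes "piecewise_constant01 h"
  shows "finite (h ` {0..1})"
proof -
  obtain J where J: "finite J"
    and h: "\<And>x y. x \<in> {0..1} \<Longrightarrow> y \<in> {0..1} \<Longrightarrow> x \<le> y \<Longrightarrow> {x..y} \<inter> J = {} \<Longrightarrow> h x = h y"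
    using assms by (auto simp: piecewise_constant01_def)
  \<comment> \<open>The second component tells a jump point from the points directly to its right,
    where h may take another value.\<close>
  define k where "k = (\<lambda>x::real. (J \<inter> {..x}, J \<inter> {..<x}))"
  have le: "h x = h y" if "x \<in> {0..1}" "y \<in> {0..1}" "k x = k y" "x < y" for x y
  proof (rule h)
    have "p \<notin> J" if "x \<le> p" "p \<le> y" for p
    proof
      assume "p \<in> J"
      then have "p \<in> J \<inter> {..x}" using \<open>k x = k y\<close> that by (auto simp: k_def)
      then have "p = x" using that by simp
      then have "p \<in> J \<inter> {..<x}" using \<open>k x = k y\<close> \<open>x < y\<close> \<open>p \<in> J\<close> by (auto simp: k_def)
      then show False using \<open>p = x\<close> by simp
    qed
    then show "{x..y} \<inter> J = {}" by auto
  qed (use that in auto)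
  have eq: "h x = h y" if "x \<in> {0..1}" "y \<in> {0..1}" "k x = k y" for x y
    using le[of x y] le[of y x] that by (metis linorder_neqE)
  have "k ` {0..1} \<subseteq> Pow J \<times> Pow J" by (auto simp: k_def)
  then have fin: "finite (k ` {0..1})"
    using J by (meson finite_Pow_iff finite_SigmaI finite_subset)
  have "h ` {0..1} \<subseteq> (\<lambda>p. h (SOME x. x \<in> {0..1} \<and> k x = p)) ` k ` {0..1}"
  proof
    fix t assume "t \<in> h ` {0..1}"
    then obtain x where x: "x \<in> {0..1}" "t = h x" by auto
    let ?y = "SOME y. y \<in> {0..1} \<and> k y = k x"
    have "?y \<in> {0..1} \<and> k ?y = k x" by (rule someI[of _ x]) (use x in auto)
    then have "t = h ?y" using eq[of x ?y] x by auto
    then show "t \<in> (\<lambda>p. h (SOME x. x \<in> {0..1} \<and> k x = p)) ` k ` {0..1}"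
      using x(1) by blast
  qed
  then show ?thesis using fin by (meson finite_imageI finite_subset)
qed

text \<open>A continuous function on a compact interval plus a function of finite range. The bound
  is made at least 1 so that it can be divided by later.\<close>

lemma piecewise_lipschitz01_bounded:
  assumes "piecewise_lipschitz01 f"
  obtains S where "1 \<le> S" "\<And>x. x \<in> {0..1} \<Longrightarrow> \<bar>f x\<bar> \<le> S"
proof -
  obtain g h L where g: "L-lipschitz_on {0..1} g" and h: "piecewise_constant01 h"
    and f: "\<And>x. x \<in> {0..1} \<Longrightarrow> f x = g x + h x"
    using assms by (auto simp: piecewise_lipschitz01_def)
  have "bounded (g ` {0..1})"
    using lipschitz_on_continuous_on[OF g] by (intro compact_imp_bounded compact_continuous_image) auto
  then obtain B where B: "\<And>x. x \<in> {0..1} \<Longrightarrow> \<bar>g x\<bar> \<le> B"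
    unfolding bounded_iff image_iff real_norm_def by blast
  obtain C where C: "\<And>x. x \<in> {0..1} \<Longrightarrow> \<bar>h x\<bar> \<le> C"
    using finite_imp_bounded[OF piecewise_constant01_finite_range[OF h]]
    unfolding bounded_iff image_iff real_norm_def by blast
  show ?thesis
  proof (rule that[of "max 1 (B + C)"])
    show "\<bar>f x\<bar> \<le> max 1 (B + C)" if "x \<in> {0..1}" for x
      using f[OF that] B[OF that] C[OF that] by linarith
  qed simp
qed

text \<open>A small ball around x inside (0,1) avoids J, so h is constant on it.\<close>

lemma piecewise_lipschitz01_isCont:
  assumes "piecewise_lipschitz01 f"
  obtains J where "finite J" "\<And>x. x \<in> {0<..<1} - J \<Longrightarrow> isCont f x"
proof -
  obtain g h L where g: "L-lipschitz_on {0..1} g" and h: "piecewise_constant01 h"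
    and f: "\<And>x. x \<in> {0..1} \<Longrightarrow> f x = g x + h x"
    using assms by (auto simp: piecewise_lipschitz01_def)
  obtain J where J: "finite J"
    and hJ: "\<And>x y. x \<in> {0..1} \<Longrightarrow> y \<in> {0..1} \<Longrightarrow> x \<le> y \<Longrightarrow> {x..y} \<inter> J = {} \<Longrightarrow> h x = h y"
    using h by (auto simp: piecewise_constant01_def)
  have "isCont f x" if x: "x \<in> {0<..<1} - J" for x
  proof -
    have "open ({0<..<1} - J)" using J by (intro open_Diff finite_imp_closed) auto
    then obtain \<delta> where \<delta>: "\<delta> > 0" "ball x \<delta> \<subseteq> {0<..<1} - J"
      using x by (meson openE)
    have h_eq: "h y = h x" if "y \<in> ball x \<delta>" for y
    proof -
      have seg: "{min x y..max x y} \<subseteq> ball x \<delta>"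
        using that by (auto simp: dist_real_def)
      then have "{min x y..max x y} \<inter> J = {}" using \<delta>(2) by blast
      moreover have "x \<in> {0..1}" "y \<in> {0..1}" using x that \<delta>(2) by force+
      ultimately have "h (min x y) = h (max x y)"
        by (intro hJ) (auto simp: min_def max_def)
      then show ?thesis by (cases "x \<le> y") (simp_all add: min_def max_def)
    qed
    have "isCont g x"
      using lipschitz_on_continuous_on[OF g] x
      by (intro continuous_on_interior[of "{0..1}"]) (auto simp: interior_atLeastAtMost_real)
    then have "isCont (\<lambda>y. g y + h x) x" by (intro continuous_intros)
    moreover have "\<forall>\<^sub>F y in nhds x. f y = g y + h x"
      unfolding eventually_nhds
    proof (intro exI[of _ "ball x \<delta>"] conjI ballI)
      fix y assume "y \<in> ball x \<delta>"
      then show "f y = g y + h x" using f[of y] h_eq[of y] \<delta>(2) by force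
    qed (use \<delta> in auto)
    ultimately show ?thesis using isCont_cong[of f "\<lambda>y. g y + h x" x] by (simp only:)
  qed
  with J that show ?thesis by blast
qed

text \<open>Values outside [0,1] are arbitrary; after the cut-off the function is continuous off the
  finite set formed by J and the two endpoints.\<close>

lemma piecewise_lipschitz01_measurable:
  assumes "piecewise_lipschitz01 f"
  shows "(\<lambda>x. indicator {0..1} x * f x) \<in> borel_measurable borel"
proof -
  obtain J where J: "finite J" "\<And>x. x \<in> {0<..<1} - J \<Longrightarrow> isCont f x"
    using piecewise_lipschitz01_isCont[OF assms] by blast
  let ?f = "\<lambda>x. indicator {0..1} x * f x :: real"
  have "isCont ?f x" if x: "x \<notin> J \<union> {0, 1}" for x
  proof (cases "x \<in> {0<..<1}")
    case True
    then have "\<forall>\<^sub>F y in nhds x. ?f y = f y"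
      unfolding eventually_nhds by (intro exI[of _ "{0<..<1}"]) auto
    then show ?thesis using J(2)[of x] x True isCont_cong[of ?f f x] by simp
  next
    case False
    then have "x \<in> - {0..1}" using x by auto
    then have "\<forall>\<^sub>F y in nhds x. ?f y = 0"
      unfolding eventually_nhds by (intro exI[of _ "- {0..1}"]) auto
    then show ?thesis using isCont_cong[of ?f "\<lambda>_. 0" x] by simp
  qed
  then have "continuous_on (- (J \<union> {0, 1})) ?f"
    by (intro continuous_at_imp_continuous_on) auto
  then show ?thesis
    using J(1) by (intro borel_measurable_continuous_countable_exceptions[of "J \<union> {0, 1}"])
      (auto intro: countable_finite)
qed

text \<open>A value different from c would persist on an interval to the right of x, which has
  positive measure. At x = 1 there is no such interval, so nothing follows there.\<close>

lemma cadlag01_AE_constant: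
  assumes "cadlag01 f" and ae: "AE x in lborel. x \<in> {0..1} \<longrightarrow> f x = c" and x: "x \<in> {0..<1}"
  shows "f x = c"
proof (rule ccontr)
  assume "f x \<noteq> c"
  have "(f \<longlongrightarrow> f x) (at_right x)" using assms by (simp add: cadlag01_def)
  then have "\<forall>\<^sub>F y in at_right x. f y \<noteq> c"
    by (rule tendsto_imp_eventually_ne) fact
  then obtain b where b: "x < b" "\<And>y. x < y \<Longrightarrow> y < b \<Longrightarrow> f y \<noteq> c"
    by (auto simp: eventually_at_right_field)
  have "AE y in lborel. y \<notin> {x<..<min b 1}"
    using ae by eventually_elim (use b x in auto)
  then have "{x<..<min b 1} \<in> null_sets lborel"
    by (subst AE_iff_null_sets) auto
  then show False
    using b x by (simp add: null_sets_def)
qed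

section \<open>Block parameters and elementary estimates for local variances\<close>

lemma admissible_blocks:
  assumes "n \<in> admissible s"
  shows "n = block_length s n * num_blocks s n" "1 \<le> block_length s n" "1 \<le> num_blocks s n"
proof -
  have n: "1 \<le> n" and "real n powr s \<in> \<nat>" "real n powr (1 - s) \<in> \<nat>"
    using assms by (auto simp: admissible_def)
  then obtain k m where km: "real n powr s = real k" "real n powr (1 - s) = real m"
    by (auto elim!: Nats_cases)
  then have bl: "block_length s n = k" "num_blocks s n = m"
    by (simp_all add: block_length_def num_blocks_def)
  have "real n = real n powr s * real n powr (1 - s)"
    using n by (simp flip: powr_add)
  then show "n = block_length s n * num_blocks s n"
    unfolding km bl by (metis of_nat_eq_iff of_nat_mult)
  have "0 < real n powr s" "0 < real n powr (1 - s)" using n by auto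
  then show "1 \<le> block_length s n" "1 \<le> num_blocks s n"
    unfolding km bl by auto
qed

lemma powr_floor_at_top:
  assumes "0 < a"
  shows "filterlim (\<lambda>n. nat \<lfloor>real n powr a\<rfloor>) at_top sequentially"
  unfolding filterlim_at_top
proof
  fix K :: nat
  have "\<forall>\<^sub>F n in sequentially. real K \<le> real n powr a"
    using eventually_ge_at_top[of "nat \<lceil>real K powr (1 / a)\<rceil>"]
  proof eventually_elim
    case (elim n)
    then have "real K powr (1 / a) \<le> real n" by linarith
    then have "(real K powr (1 / a)) powr a \<le> real n powr a"
      using assms by (intro powr_mono2) auto
    then show ?case using assms by (simp add: powr_powr)
  qed
  then show "\<forall>\<^sub>F n in sequentially. K \<le> nat \<lfloor>real n powr a\<rfloor>"
    by eventually_elim (rule le_nat_floor)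
qed

lemma local_var_cong:
  assumes "\<And>i. i \<in> {(j - 1) * l + 1..j * l} \<Longrightarrow> X i \<omega> = X' i \<omega>"
  shows "local_var l X j \<omega> = local_var l X' j \<omega>"
  using assms by (simp add: local_var_def local_mean_def)

lemma local_var_nonneg: "0 \<le> local_var l X j \<omega>"
  by (simp add: local_var_def sum_nonneg)

text \<open>The centre c is free: the law of large numbers takes the constant mean, the domination
  argument takes 0.\<close>

lemma local_var_eq:
  assumes "1 \<le> j" "1 \<le> l"
  shows "local_var l X j \<omega> = 1 / real l * (\<Sum>i = (j - 1) * l + 1..j * l. (X i \<omega> - c)\<^sup>2)
      - (1 / real l * (\<Sum>i = (j - 1) * l + 1..j * l. X i \<omega> - c))\<^sup>2"
proof -
  let ?I = "{(j - 1) * l + 1..j * l}"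
  define a where "a = 1 / real l * (\<Sum>i\<in>?I. X i \<omega> - c)"
  have card: "real (card ?I) = real l"
    using assms by (cases j) auto
  have sum_a: "(\<Sum>i\<in>?I. X i \<omega> - c) = real l * a" using assms by (simp add: a_def)
  have "(\<Sum>i\<in>?I. X i \<omega>) = (\<Sum>i\<in>?I. X i \<omega> - c) + (\<Sum>i\<in>?I. c)"
    unfolding sum.distrib[symmetric] by simp
  also have "\<dots> = real l * (a + c)"
    unfolding sum_a sum_constant card by (simp add: distrib_left)
  finally have mean: "local_mean l X j \<omega> = a + c"
    unfolding local_mean_def using assms by simp
  have "(\<Sum>i\<in>?I. (X i \<omega> - (a + c))\<^sup>2)
      = (\<Sum>i\<in>?I. (X i \<omega> - c)\<^sup>2 - 2 * a * (X i \<omega> - c) + a\<^sup>2)"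
    by (intro sum.cong refl) (simp add: power2_eq_square algebra_simps)
  also have "\<dots> = (\<Sum>i\<in>?I. (X i \<omega> - c)\<^sup>2) - 2 * a * (\<Sum>i\<in>?I. X i \<omega> - c) + (\<Sum>i\<in>?I. a\<^sup>2)"
    by (simp only: sum.distrib sum_subtractf sum_distrib_left right_diff_distrib)
  also have "\<dots> = (\<Sum>i\<in>?I. (X i \<omega> - c)\<^sup>2) - real l * a\<^sup>2"
    unfolding sum_a sum_constant card by (simp add: power2_eq_square algebra_simps)
  finally show ?thesis
    unfolding local_var_def mean a_def[symmetric] using assms by (simp add: right_diff_distrib)
qed

text \<open>One factor |sqrt a - c| is enlarged to sqrt a + c, which completes a difference of
  squares.\<close>

lemma sqrt_diff_square_le:
  fixes a c :: real
  assumes "0 \<le> a" "0 \<le> c"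
  shows "(sqrt a - c)\<^sup>2 \<le> \<bar>a - c\<^sup>2\<bar>"
proof -
  have "(sqrt a - c)\<^sup>2 = \<bar>sqrt a - c\<bar> * \<bar>sqrt a - c\<bar>" by (simp add: power2_eq_square)
  also have "\<dots> \<le> \<bar>sqrt a - c\<bar> * \<bar>sqrt a + c\<bar>"
    using assms real_sqrt_ge_zero[OF assms(1)] by (intro mult_left_mono) linarith+
  also have "\<dots> = \<bar>(sqrt a)\<^sup>2 - c\<^sup>2\<bar>"
    by (simp add: abs_mult[symmetric] power2_eq_square algebra_simps)
  finally show ?thesis using assms by simp
qed

lemma (in prob_space) strictly_stationary_integral:
  fixes f :: "real \<Rightarrow> real"
  assumes meas: "\<And>i. 1 \<le> i \<Longrightarrow> Y i \<in> borel_measurable M" and stat: "strictly_stationary M Y"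
    and f: "f \<in> borel_measurable borel" and i: "1 \<le> i"
  shows "integrable M (\<lambda>\<omega>. f (Y i \<omega>)) \<longleftrightarrow> integrable M (\<lambda>\<omega>. f (Y 1 \<omega>))"
    "expectation (\<lambda>\<omega>. f (Y i \<omega>)) = expectation (\<lambda>\<omega>. f (Y 1 \<omega>))"
  using integrable_distr_eq[OF meas[OF i] f] integrable_distr_eq[OF meas[of 1] f]
    integral_distr[OF meas[OF i] f] integral_distr[OF meas[of 1] f]
    strictly_stationary_distr[OF meas stat i]
  by simp_all

lemma local_var_measurable:
  assumes "\<And>i. 1 \<le> i \<Longrightarrow> X i \<in> borel_measurable M"
  shows "(\<lambda>\<omega>. local_var l X j \<omega>) \<in> borel_measurable M"
proof -
  have [measurable]: "(\<lambda>\<omega>. X i \<omega>) \<in> borel_measurable M" if "i \<in> {(j - 1) * l + 1..j * l}" for i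
    using assms[of i] that by auto
  show ?thesis unfolding local_var_def local_mean_def by measurable
qed

text \<open>A squared block mean must be controlled in L^1, while the law of large numbers controls
  only E|m|. If |m| \<le> 2 S, then m^2 is at most 2 S |m|. Otherwise V \<ge> m^2 \<ge> 4 w, so the
  deviation of the second moment V from its target w is large enough to pay for m^2.\<close>

lemma square_le_of_le_square_mean:
  fixes m V w S :: real
  assumes "m\<^sup>2 \<le> V" "w \<le> S\<^sup>2" "0 \<le> S"
  shows "m\<^sup>2 \<le> 2 * S * \<bar>m\<bar> + 2 * \<bar>V - w\<bar>"
proof (cases "\<bar>m\<bar> \<le> 2 * S")
  case True
  have "m\<^sup>2 = \<bar>m\<bar> * \<bar>m\<bar>" by (simp add: power2_eq_square)
  also have "\<dots> \<le> 2 * S * \<bar>m\<bar>" using True by (intro mult_right_mono) auto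
  finally show ?thesis by (rule order_trans) simp
next
  case False
  then have "(2 * S)\<^sup>2 \<le> \<bar>m\<bar>\<^sup>2" using assms(3) by (intro power_mono) auto
  then have "4 * S\<^sup>2 \<le> m\<^sup>2" by (simp add: power_mult_distrib)
  then have "m\<^sup>2 \<le> 2 * V - 2 * w" using assms(1,2) zero_le_power2[of S] by linarith
  also have "\<dots> = 2 * (V - w)" by simp
  also have "\<dots> \<le> 2 * \<bar>V - w\<bar>" by (intro mult_left_mono) auto
  also have "\<dots> \<le> 2 * S * \<bar>m\<bar> + 2 * \<bar>V - w\<bar>" using assms(3) by simp
  finally show ?thesis .
qed

section \<open>Convergence of the local variances in mean\<close>

text \<open>The scales s i are absorbed into weights, (s i)^2 / S^2 for the squares and s i / S for
  the means, so that one \<open>L\<close> serves all blocks, all scales bounded by S and all targets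
  v.\<close>

lemma (in prob_space) local_var_LLN:
  assumes meas: "\<And>i. 1 \<le> i \<Longrightarrow> Y i \<in> borel_measurable M"
    and stat: "strictly_stationary M Y" and mixing: "alpha_mixing M Y"
    and int2: "integrable M (\<lambda>\<omega>. (Y 1 \<omega>)\<^sup>2)"
    and E1: "expectation (Y 1) = 0" and E2: "expectation (\<lambda>\<omega>. (Y 1 \<omega>)\<^sup>2) = 1"
    and "S > 0" "\<epsilon> > 0"
  shows "\<exists>L. \<forall>l\<ge>L. \<forall>j\<ge>1. \<forall>c s v.
           (\<forall>i\<in>{(j - 1) * l + 1..j * l}. \<bar>s i\<bar> \<le> S \<and> \<bar>(s i)\<^sup>2 - v\<bar> \<le> \<epsilon>) \<longrightarrow>
           expectation (\<lambda>\<omega>. \<bar>local_var l (\<lambda>i \<omega>. c + s i * Y i \<omega>) j \<omega> - v\<bar>) \<le> 2 * \<epsilon>"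
proof -
  \<comment> \<open>The final bound is \<epsilon> + (3 + 2) S^2 \<eta> = 2 \<epsilon>.\<close>
  define \<eta> where "\<eta> = \<epsilon> / (5 * S\<^sup>2)"
  have \<eta>: "\<eta> > 0" using \<open>S > 0\<close> \<open>\<epsilon> > 0\<close> by (simp add: \<eta>_def)
  have int1: "integrable M (Y 1)"
    by (rule expectation_abs_le_sqrt(1)[OF meas int2]) simp
  have intY: "integrable M (Y i)" if "1 \<le> i" for i
    using strictly_stationary_integral(1)[OF meas stat, of "\<lambda>y. y" i] int1 that by simp
  have intY2: "integrable M (\<lambda>\<omega>. (Y i \<omega>)\<^sup>2)" if "1 \<le> i" for i
    using strictly_stationary_integral(1)[OF meas stat, of "\<lambda>y. y\<^sup>2" i] int2 that by simp
  have "\<exists>L. \<forall>l\<ge>L. \<forall>m w. (\<forall>i. \<bar>w i\<bar> \<le> 1) \<longrightarrow>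
      expectation (\<lambda>\<omega>. \<bar>1 / real l * (\<Sum>i = m + 1..m + l. w i * ((Y i \<omega>)\<^sup>2 - 1))\<bar>) \<le> \<eta>"
    by (rule alpha_mixing_weighted_LLN[OF meas stat mixing int2 _ \<eta>, unfolded E2]) simp_all
  then obtain L1 where L1: "\<And>l m w. l \<ge> L1 \<Longrightarrow> (\<forall>i. \<bar>w i\<bar> \<le> 1) \<Longrightarrow>
      expectation (\<lambda>\<omega>. \<bar>1 / real l * (\<Sum>i = m + 1..m + l. w i * ((Y i \<omega>)\<^sup>2 - 1))\<bar>) \<le> \<eta>"
    by blast
  have "\<exists>L. \<forall>l\<ge>L. \<forall>m w. (\<forall>i. \<bar>w i\<bar> \<le> 1) \<longrightarrow>
      expectation (\<lambda>\<omega>. \<bar>1 / real l * (\<Sum>i = m + 1..m + l. w i * (Y i \<omega> - expectation (\<lambda>\<omega>. Y 1 \<omega>)))\<bar>) \<le> \<eta>"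
    by (rule alpha_mixing_weighted_LLN[OF meas stat mixing _ _ \<eta>, of "\<lambda>y. y"]) (use int1 in simp_all)
  then obtain L2 where L2: "\<And>l m w. l \<ge> L2 \<Longrightarrow> (\<forall>i. \<bar>w i\<bar> \<le> 1) \<Longrightarrow>
      expectation (\<lambda>\<omega>. \<bar>1 / real l * (\<Sum>i = m + 1..m + l. w i * Y i \<omega>)\<bar>) \<le> \<eta>"
    unfolding E1 diff_zero by blast
  show ?thesis
  proof (intro exI[of _ "max 1 (max L1 L2)"] allI impI)
    fix l j :: nat and c v :: real and s :: "nat \<Rightarrow> real"
    assume l: "max 1 (max L1 L2) \<le> l" and j: "1 \<le> j"
    define m where "m = (j - 1) * l"
    have jl: "j * l = m + l" using j by (cases j) (auto simp: m_def)
    let ?I = "{m + 1..m + l}"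
    assume "\<forall>i\<in>{(j - 1) * l + 1..j * l}. \<bar>s i\<bar> \<le> S \<and> \<bar>(s i)\<^sup>2 - v\<bar> \<le> \<epsilon>"
    then have s: "\<bar>s i\<bar> \<le> S" "\<bar>(s i)\<^sup>2 - v\<bar> \<le> \<epsilon>" if "i \<in> ?I" for i
      using that unfolding jl m_def[symmetric] by auto
    have l1: "1 \<le> l" "real l > 0" using l by auto
    have s2: "(s i)\<^sup>2 \<le> S\<^sup>2" if "i \<in> ?I" for i
      using s(1)[OF that] \<open>S > 0\<close> by (metis abs_ge_zero power2_abs power_mono)
    \<comment> \<open>Extended by 0 outside the block, where nothing is known about s but the law of
      large numbers still asks for |w i| \<le> 1.\<close>
    define w1 where "w1 = (\<lambda>i. if i \<in> ?I then (s i)\<^sup>2 / S\<^sup>2 else 0)"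
    define w2 where "w2 = (\<lambda>i. if i \<in> ?I then s i / S else 0)"
    have w: "\<bar>w1 i\<bar> \<le> 1" "\<bar>w2 i\<bar> \<le> 1" for i
      using s(1)[of i] s2[of i] \<open>S > 0\<close> by (auto simp: w1_def w2_def divide_le_eq)
    define T1 where "T1 = (\<lambda>\<omega>. 1 / real l * (\<Sum>i\<in>?I. w1 i * ((Y i \<omega>)\<^sup>2 - 1)))"
    define T2 where "T2 = (\<lambda>\<omega>. 1 / real l * (\<Sum>i\<in>?I. w2 i * Y i \<omega>))"
    have T_E: "expectation (\<lambda>\<omega>. \<bar>T1 \<omega>\<bar>) \<le> \<eta>" "expectation (\<lambda>\<omega>. \<bar>T2 \<omega>\<bar>) \<le> \<eta>"
      unfolding T1_def T2_def using L1[of l w1 m] L2[of l w2 m] l w by auto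
    have T_int: "integrable M T1" "integrable M T2"
      unfolding T1_def T2_def using intY intY2
      by (intro integrable_mult_right Bochner_Integration.integrable_sum Bochner_Integration.integrable_diff; simp)+
    \<comment> \<open>The conditional target: the second moment of the block fluctuates around
      \<open>vbar\<close>, which in turn is within \<epsilon> of v.\<close>
    define vbar where "vbar = 1 / real l * (\<Sum>i\<in>?I. (s i)\<^sup>2)"
    have card: "(\<Sum>i\<in>?I. a) = real l * a" for a :: real by simp
    have vbar_le: "vbar \<le> S\<^sup>2"
    proof -
      have "(\<Sum>i\<in>?I. (s i)\<^sup>2) \<le> real l * S\<^sup>2"
        unfolding card[symmetric] by (intro sum_mono s2)
      then show ?thesis using l1 by (simp add: vbar_def divide_le_eq mult.commute)
    qed
    have vbar_v: "\<bar>vbar - v\<bar> \<le> \<epsilon>"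
    proof -
      have "vbar - v = 1 / real l * (\<Sum>i\<in>?I. (s i)\<^sup>2 - v)"
        unfolding sum_subtractf card vbar_def using l1 by (simp add: right_diff_distrib)
      also have "\<bar>\<dots>\<bar> \<le> 1 / real l * (\<Sum>i\<in>?I. \<epsilon>)"
        unfolding abs_mult using s(2)
        by (intro mult_mono order_trans[OF sum_abs] sum_mono) auto
      finally show ?thesis unfolding card using l1 by simp
    qed
    let ?lv = "\<lambda>\<omega>. local_var l (\<lambda>i \<omega>. c + s i * Y i \<omega>) j \<omega>"
    \<comment> \<open>Of the coefficient 3, one part comes from V - vbar and two from the estimate
      of the squared mean. The doubled absolute value is the form in which
      \<open>expectation_dominated\<close> takes a nonnegative integrand.\<close>
    have bound: "\<bar>\<bar>?lv \<omega> - v\<bar>\<bar> \<le> 3 * S\<^sup>2 * \<bar>T1 \<omega>\<bar> + \<epsilon> + 2 * S\<^sup>2 * \<bar>T2 \<omega>\<bar>" for \<omega>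
    proof -
      define V where "V = 1 / real l * (\<Sum>i\<in>?I. (s i * Y i \<omega>)\<^sup>2)"
      define mm where "mm = 1 / real l * (\<Sum>i\<in>?I. s i * Y i \<omega>)"
      have lv: "?lv \<omega> = V - mm\<^sup>2"
        using local_var_eq[OF j l1(1), of "\<lambda>i \<omega>. c + s i * Y i \<omega>" \<omega> c]
        unfolding V_def mm_def jl m_def[symmetric] by simp
      then have mmV: "mm\<^sup>2 \<le> V" using local_var_nonneg[of l _ j \<omega>] by (metis diff_ge_0_iff_ge)
      have "S\<^sup>2 * (\<Sum>i\<in>?I. w1 i * ((Y i \<omega>)\<^sup>2 - 1)) = (\<Sum>i\<in>?I. (s i * Y i \<omega>)\<^sup>2 - (s i)\<^sup>2)"
        unfolding sum_distrib_left using \<open>S > 0\<close>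
        by (intro sum.cong refl) (simp add: w1_def power_mult_distrib right_diff_distrib)
      then have V: "V - vbar = S\<^sup>2 * T1 \<omega>"
        unfolding T1_def V_def vbar_def by (simp add: sum_subtractf diff_divide_distrib)
      have "S * (\<Sum>i\<in>?I. w2 i * Y i \<omega>) = (\<Sum>i\<in>?I. s i * Y i \<omega>)"
        unfolding sum_distrib_left using \<open>S > 0\<close> by (intro sum.cong refl) (simp add: w2_def)
      then have mm: "mm = S * T2 \<omega>" unfolding T2_def mm_def by simp
      have "mm\<^sup>2 \<le> 2 * S * \<bar>mm\<bar> + 2 * \<bar>V - vbar\<bar>"
        by (rule square_le_of_le_square_mean[OF mmV vbar_le]) (use \<open>S > 0\<close> in simp)
      then have "mm\<^sup>2 \<le> 2 * S\<^sup>2 * \<bar>T2 \<omega>\<bar> + 2 * (S\<^sup>2 * \<bar>T1 \<omega>\<bar>)"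
        unfolding V mm abs_mult using \<open>S > 0\<close> by (simp add: power2_eq_square)
      moreover have "\<bar>?lv \<omega> - v\<bar> \<le> \<bar>V - vbar\<bar> + \<bar>vbar - v\<bar> + mm\<^sup>2"
        unfolding lv by (smt (verit) zero_le_power2)
      moreover have "\<bar>V - vbar\<bar> = S\<^sup>2 * \<bar>T1 \<omega>\<bar>" unfolding V abs_mult by simp
      ultimately show ?thesis using vbar_v by linarith
    qed
    have "expectation (\<lambda>\<omega>. \<bar>?lv \<omega> - v\<bar>)
        \<le> expectation (\<lambda>\<omega>. 3 * S\<^sup>2 * \<bar>T1 \<omega>\<bar> + \<epsilon> + 2 * S\<^sup>2 * \<bar>T2 \<omega>\<bar>)"
    proof (rule expectation_dominated(2)[OF _ _ bound])
      have "(\<lambda>\<omega>. ?lv \<omega>) \<in> borel_measurable M"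
        by (rule local_var_measurable) (use meas in auto)
      then show "(\<lambda>\<omega>. \<bar>?lv \<omega> - v\<bar>) \<in> borel_measurable M" by measurable
    qed (use T_int in simp)
    also have "\<dots> = 3 * S\<^sup>2 * expectation (\<lambda>\<omega>. \<bar>T1 \<omega>\<bar>) + \<epsilon> + 2 * S\<^sup>2 * expectation (\<lambda>\<omega>. \<bar>T2 \<omega>\<bar>)"
      using T_int by (simp add: prob_space)
    also have "\<dots> \<le> 3 * S\<^sup>2 * \<eta> + \<epsilon> + 2 * S\<^sup>2 * \<eta>"
      using T_E by (intro add_mono mult_left_mono) auto
    also have "\<dots> = 2 * \<epsilon>" using \<open>S > 0\<close> by (simp add: \<eta>_def)
    finally show "expectation (\<lambda>\<omega>. \<bar>?lv \<omega> - v\<bar>) \<le> 2 * \<epsilon>" .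
  qed
qed

lemma psi_sq_eq_unif01:
  assumes "prob_space P"
    and "distributed P lborel Z std_normal_density"
    and "distributed P lborel Z' std_normal_density"
    and "prob_space.indep_var P borel Z borel Z'"
    and "cond_abs_version P Z Z' G" and [measurable]: "\<tau> \<in> borel_measurable borel"
    and "\<And>x. x \<in> {0..1} \<Longrightarrow> \<sigma> x = \<tau> x"
  shows "psi_sq P Z Z' G \<sigma> = 4 * (\<integral>x. \<integral>z.
      (\<integral>y. gauss_abs_centred (\<tau> x) (\<tau> y) z \<partial>unif01)\<^sup>2 \<partial>std_normal_distribution \<partial>unif01)"
proof -
  have inner: "(LBINT y:{0..1}. gauss_abs_centred x (\<tau> y) z) = (\<integral>y. gauss_abs_centred x (\<tau> y) z \<partial>unif01)" for x z
    by (rule integral_unif01[symmetric]) measurable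
  have [measurable]: "(\<lambda>x. \<integral>z. (\<integral>y. gauss_abs_centred (\<tau> x) (\<tau> y) z \<partial>unif01)\<^sup>2 \<partial>std_normal_distribution)
      \<in> borel_measurable borel"
    by (rule std_normal.borel_measurable_lebesgue_integral) measurable
  have "psi_sq P Z Z' G \<sigma> = 4 * (LBINT x:{0..1}. \<integral>z.
      (LBINT y:{0..1}. gauss_abs_centred (\<tau> x) (\<tau> y) z)\<^sup>2 \<partial>std_normal_distribution)"
    by (rule psi_sq_eq) (use assms in auto)
  then show ?thesis
    unfolding inner by (subst integral_unif01) simp_all
qed

text \<open>The value 0 off the admissible set turns convergence along that set into convergence of
  an ordinary sequence, to which dominated convergence applies.\<close>

lemma (in prob_space) blockwise_variance_tendsto:
  fixes \<mu> \<sigma> \<tau> :: "real \<Rightarrow> real" and Y :: "nat \<Rightarrow> 'a \<Rightarrow> real"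
  assumes meas: "\<And>i. 1 \<le> i \<Longrightarrow> Y i \<in> borel_measurable M"
    and stat: "strictly_stationary M Y" and mixing: "alpha_mixing M Y"
    and int2: "integrable M (\<lambda>\<omega>. (Y 1 \<omega>)\<^sup>2)"
    and E1: "expectation (Y 1) = 0" and E2: "expectation (\<lambda>\<omega>. (Y 1 \<omega>)\<^sup>2) = 1"
    and \<mu>: "\<And>x. x \<in> {0..<1} \<Longrightarrow> \<mu> x = \<mu>H"
    and J: "finite J" "\<And>x. x \<in> {0<..<1} - J \<Longrightarrow> isCont \<sigma> x"
    and S: "1 \<le> S" "\<And>x. x \<in> {0..1} \<Longrightarrow> \<bar>\<sigma> x\<bar> \<le> S"
    and s: "0 < s" "s < 1"
    and [measurable]: "\<tau> \<in> borel_measurable borel"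
    and \<tau>: "\<And>x. x \<in> {0..1} \<Longrightarrow> \<tau> x = \<sigma> x" "\<And>x. \<bar>\<tau> x\<bar> \<le> S"
  defines "f \<equiv> \<lambda>n \<omega> x. \<bar>local_var (block_length s n) (obs \<mu> \<sigma> Y n) (block_index (num_blocks s n) x) \<omega> - (\<tau> x)\<^sup>2\<bar>"
  shows "\<And>n \<omega>. n \<in> admissible s \<Longrightarrow> integrable unif01 (f n \<omega>)"
    and "\<And>n. n \<in> admissible s \<Longrightarrow> integrable M (\<lambda>\<omega>. \<integral>x. f n \<omega> x \<partial>unif01)"
    and "(\<lambda>n. if n \<in> admissible s then expectation (\<lambda>\<omega>. \<integral>x. f n \<omega> x \<partial>unif01) else 0) \<longlonglongrightarrow> 0"
proof -
  interpret U: pair_sigma_finite unif01 M ..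
  let ?A = "admissible s" and ?l = "block_length s" and ?b = "num_blocks s"
  let ?X = "\<lambda>n. obs \<mu> \<sigma> Y n"
  \<comment> \<open>The value of \<mu> at 1 may differ from \<open>\<mu>H\<close> and is seen by the
    observation i = n.\<close>
  define B where "B = \<bar>\<mu>H\<bar> + \<bar>\<mu> 1\<bar>"
  \<comment> \<open>The first two terms bound the expected local variance, the last one bounds
    \<open>(\<tau> x)\<^sup>2\<close>.\<close>
  define K where "K = 2 * B\<^sup>2 + 2 * S\<^sup>2 + S\<^sup>2"
  have B: "\<bar>\<mu> x\<bar> \<le> B" if "x \<in> {0..1}" for x
    using that \<mu>[of x] by (cases "x = 1") (auto simp: B_def)
  have X_meas: "(\<lambda>\<omega>. ?X n i \<omega>) \<in> borel_measurable M" if "1 \<le> i" for n i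
    using meas[OF that] unfolding obs_def by measurable
  have lv_meas: "(\<lambda>\<omega>. local_var l (?X n) j \<omega>) \<in> borel_measurable M" for l n j
    by (rule local_var_measurable) (use X_meas in auto)
  have f_meas: "(\<lambda>(x, \<omega>). f n \<omega> x) \<in> borel_measurable (unif01 \<Otimes>\<^sub>M M)" for n
  proof -
    have [measurable]: "(\<lambda>p. local_var (?l n) (?X n) j (snd p)) \<in> borel_measurable (unif01 \<Otimes>\<^sub>M M)" for j
      by (rule measurable_compose[OF measurable_snd lv_meas])
    have [measurable]: "(\<lambda>p. block_index (?b n) (fst p)) \<in> measurable (unif01 \<Otimes>\<^sub>M M) (count_space UNIV)"
      by measurable
    \<comment> \<open>For each fixed index this is a random variable, and the block index takes only
      countably many values.\<close>
    have "(\<lambda>p. local_var (?l n) (?X n) (block_index (?b n) (fst p)) (snd p)) \<in> borel_measurable (unif01 \<Otimes>\<^sub>M M)"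
      by (rule measurable_compose_countable) measurable
    then show ?thesis unfolding f_def case_prod_beta by measurable
  qed
  show f_int: "integrable unif01 (f n \<omega>)" if n: "n \<in> ?A" for n \<omega>
  proof -
    have "integrable unif01 (\<lambda>x. (\<tau> x)\<^sup>2)"
      using \<tau>(2) by (intro unif01.integrable_const_bound[of _ "S\<^sup>2"] AE_I2)
        (auto intro!: abs_le_square_iff[THEN iffD1] simp: order_trans[OF _ abs_ge_self])
    then show ?thesis
      unfolding f_def
      using unif01_block_index(1)[OF admissible_blocks(3)[OF n], of "\<lambda>j. local_var (?l n) (?X n) j \<omega>"]
      by (intro integrable_abs Bochner_Integration.integrable_diff) 
  qed
  have intY: "integrable M (Y i)" "expectation (Y i) = 0" if "1 \<le> i" for i
  proof -
    have "integrable M (Y 1)"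
      by (rule expectation_abs_le_sqrt(1)[OF meas int2]) simp
    then show "integrable M (Y i)" "expectation (Y i) = 0"
      using strictly_stationary_integral[OF meas stat, of "\<lambda>y. y" i] E1 that by simp_all
  qed
  have intY2: "integrable M (\<lambda>\<omega>. (Y i \<omega>)\<^sup>2)" "expectation (\<lambda>\<omega>. (Y i \<omega>)\<^sup>2) = 1" if "1 \<le> i" for i
    using strictly_stationary_integral[OF meas stat, of "\<lambda>y. y\<^sup>2" i] int2 E2 that by simp_all
  \<comment> \<open>A local variance is at most the block average of the squared observations, and
    these are bounded by (a + b)^2 \<le> 2 a^2 + 2 b^2. The range of j keeps i/n inside
    [0,1].\<close>
  have lv_bound: "integrable M (\<lambda>\<omega>. local_var (?l n) (?X n) j \<omega>)"
      "expectation (\<lambda>\<omega>. local_var (?l n) (?X n) j \<omega>) \<le> 2 * B\<^sup>2 + 2 * S\<^sup>2"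
    if n: "n \<in> ?A" and j: "j \<in> {1..?b n}" for n j
  proof -
    let ?I = "{(j - 1) * ?l n + 1..j * ?l n}"
    note blk = admissible_blocks[OF n]
    have card: "(\<Sum>i\<in>?I. a) = real (?l n) * a" for a :: real
      using j by (cases j) auto
    have "j * ?l n \<le> n"
    proof -
      have "j * ?l n \<le> ?b n * ?l n" using j by (intro mult_le_mono1) simp
      then show ?thesis using blk(1) by (simp add: mult.commute)
    qed
    then have unit: "real i / real n \<in> {0..1}" "1 \<le> i" if "i \<in> ?I" for i
      using that by auto
    let ?g = "\<lambda>\<omega>. 1 / real (?l n) * (\<Sum>i\<in>?I. 2 * B\<^sup>2 + 2 * S\<^sup>2 * (Y i \<omega>)\<^sup>2)"
    have g_int: "integrable M ?g"
      using intY2(1) unit(2) by (intro integrable_mult_right Bochner_Integration.integrable_sum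
        Bochner_Integration.integrable_add) auto
    have le: "\<bar>local_var (?l n) (?X n) j \<omega>\<bar> \<le> ?g \<omega>" for \<omega>
    proof -
      have "\<bar>local_var (?l n) (?X n) j \<omega>\<bar> \<le> 1 / real (?l n) * (\<Sum>i\<in>?I. (?X n i \<omega>)\<^sup>2)"
        using local_var_eq[of j "?l n" "?X n" \<omega> 0] local_var_nonneg[of "?l n" "?X n" j \<omega>] blk j by simp
      also have "\<dots> \<le> ?g \<omega>"
      proof (intro mult_left_mono sum_mono)
        fix i assume i: "i \<in> ?I"
        let ?x = "real i / real n"
        have "(?X n i \<omega>)\<^sup>2 \<le> 2 * (\<mu> ?x)\<^sup>2 + 2 * (\<sigma> ?x * Y i \<omega>)\<^sup>2"
          unfolding obs_def using sum_squares_bound[of "\<mu> ?x" "\<sigma> ?x * Y i \<omega>"]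
          by (simp add: power2_sum)
        also have "\<dots> = 2 * (\<mu> ?x)\<^sup>2 + 2 * (\<sigma> ?x)\<^sup>2 * (Y i \<omega>)\<^sup>2"
          by (simp add: power_mult_distrib)
        also have "\<dots> \<le> 2 * B\<^sup>2 + 2 * S\<^sup>2 * (Y i \<omega>)\<^sup>2"
          using B[OF unit(1)[OF i]] S(2)[OF unit(1)[OF i]] S(1)
          by (intro add_mono mult_left_mono mult_right_mono abs_le_square_iff[THEN iffD1])
             (auto simp: order_trans[OF _ abs_ge_self])
        finally show "(?X n i \<omega>)\<^sup>2 \<le> 2 * B\<^sup>2 + 2 * S\<^sup>2 * (Y i \<omega>)\<^sup>2" .
      qed simp
      finally show ?thesis .
    qed
    show "integrable M (\<lambda>\<omega>. local_var (?l n) (?X n) j \<omega>)"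
      by (rule expectation_dominated(1)[OF lv_meas g_int le])
    have "expectation (\<lambda>\<omega>. local_var (?l n) (?X n) j \<omega>) \<le> expectation ?g"
      by (rule expectation_dominated(2)[OF lv_meas g_int le])
    also have "\<dots> = 1 / real (?l n) * (\<Sum>i\<in>?I. expectation (\<lambda>\<omega>. 2 * B\<^sup>2 + 2 * S\<^sup>2 * (Y i \<omega>)\<^sup>2))"
      using intY2(1) unit(2) by (subst integral_mult_right_zero, subst Bochner_Integration.integral_sum) auto
    also have "(\<Sum>i\<in>?I. expectation (\<lambda>\<omega>. 2 * B\<^sup>2 + 2 * S\<^sup>2 * (Y i \<omega>)\<^sup>2)) = (\<Sum>i\<in>?I. 2 * B\<^sup>2 + 2 * S\<^sup>2)"
    proof (rule sum.cong[OF refl])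
      fix i assume "i \<in> ?I"
      from intY2[OF unit(2)[OF this]]
      show "expectation (\<lambda>\<omega>. 2 * B\<^sup>2 + 2 * S\<^sup>2 * (Y i \<omega>)\<^sup>2) = 2 * B\<^sup>2 + 2 * S\<^sup>2"
        by (simp add: prob_space)
    qed
    also have "1 / real (?l n) * \<dots> = 2 * B\<^sup>2 + 2 * S\<^sup>2"
      unfolding card using blk(2) by simp
    finally show "expectation (\<lambda>\<omega>. local_var (?l n) (?X n) j \<omega>) \<le> 2 * B\<^sup>2 + 2 * S\<^sup>2" .
  qed
  define d where "d = (\<lambda>n x. if n \<in> ?A then expectation (\<lambda>\<omega>. f n \<omega> x) else 0)"
  have f_intM: "integrable M (\<lambda>\<omega>. f n \<omega> x)" and d_bound: "d n x \<le> K"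
    if n: "n \<in> ?A" and x: "x \<in> {0..<1}" for n x
  proof -
    note lv = lv_bound[OF n block_index_range[OF admissible_blocks(3)[OF n] x]]
    show int: "integrable M (\<lambda>\<omega>. f n \<omega> x)" unfolding f_def using lv(1) by simp
    have "d n x \<le> expectation (\<lambda>\<omega>. local_var (?l n) (?X n) (block_index (?b n) x) \<omega> + (\<tau> x)\<^sup>2)"
      unfolding d_def using n
    proof (simp, intro integral_mono int)
      show "f n \<omega> x \<le> local_var (?l n) (?X n) (block_index (?b n) x) \<omega> + (\<tau> x)\<^sup>2" for \<omega>
        unfolding f_def using local_var_nonneg[of "?l n" "?X n" "block_index (?b n) x" \<omega>]
        by (intro abs_leI) (auto simp: algebra_simps)
    qed (use lv(1) in simp)
    also have "\<dots> = expectation (\<lambda>\<omega>. local_var (?l n) (?X n) (block_index (?b n) x) \<omega>) + (\<tau> x)\<^sup>2"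
      using lv(1) by (simp add: prob_space)
    also have "(\<tau> x)\<^sup>2 \<le> S\<^sup>2"
      using \<tau>(2)[of x] S(1) by (intro abs_le_square_iff[THEN iffD1]) simp
    finally show "d n x \<le> K" using lv(2) by (simp add: K_def)
  qed
  have d_nonneg: "0 \<le> d n x" for n x by (simp add: d_def f_def)
  have d_meas [measurable]: "d n \<in> borel_measurable borel" for n
    using borel_measurable_lebesgue_integral[OF f_meas[of n]] unfolding d_def by (cases "n \<in> ?A") auto
  have prod_int: "integrable (unif01 \<Otimes>\<^sub>M M) (\<lambda>(x, \<omega>). f n \<omega> x)" if n: "n \<in> ?A" for n
  proof (rule U.Fubini_integrable[OF f_meas])
    have "integrable unif01 (d n)"
    proof (rule unif01.integrable_const_bound[of _ K])
      show "AE x in unif01. norm (d n x) \<le> K"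
        using AE_unif01 by eventually_elim (use d_bound[OF n] d_nonneg in simp)
    qed simp
    then show "integrable unif01 (\<lambda>x. expectation (\<lambda>\<omega>. norm (case (x, \<omega>) of (x, \<omega>) \<Rightarrow> f n \<omega> x)))"
      using n by (simp add: d_def f_def)
    show "AE x in unif01. integrable M (\<lambda>\<omega>. case (x, \<omega>) of (x, \<omega>) \<Rightarrow> f n \<omega> x)"
      using AE_unif01 by eventually_elim (use f_intM[OF n] in simp)
  qed
  show "integrable M (\<lambda>\<omega>. \<integral>x. f n \<omega> x \<partial>unif01)" if n: "n \<in> ?A" for n
    using U.integrable_snd[OF prod_int[OF n]] .
  have E_eq: "(if n \<in> ?A then expectation (\<lambda>\<omega>. \<integral>x. f n \<omega> x \<partial>unif01) else 0) = (\<integral>x. d n x \<partial>unif01)" for n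
    using U.Fubini_integral[OF prod_int[of n]] by (simp add: d_def)
  have pointwise: "(\<lambda>n. d n x) \<longlonglongrightarrow> 0" if x: "x \<in> {0<..<1} - J" for x
  proof (rule LIMSEQ_I)
    fix r :: real assume "0 < r"
    \<comment> \<open>\<open>local_var_LLN\<close> yields 2 \<epsilon>, which stays strictly below
      r.\<close>
    define \<epsilon> where "\<epsilon> = r / 3"
    have \<epsilon>: "\<epsilon> > 0" using \<open>0 < r\<close> by (simp add: \<epsilon>_def)
    have "isCont (\<lambda>y. (\<sigma> y)\<^sup>2) x" using J(2)[OF x] by (intro continuous_intros)
    then obtain \<delta>0 where \<delta>0: "\<delta>0 > 0" "\<And>y. \<bar>y - x\<bar> < \<delta>0 \<Longrightarrow> \<bar>(\<sigma> y)\<^sup>2 - (\<sigma> x)\<^sup>2\<bar> < \<epsilon>"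
      using \<epsilon> unfolding continuous_at_eps_delta dist_real_def by meson
    \<comment> \<open>The second term of the minimum keeps the block of x away from i = n, where the
      mean is \<mu>(1).\<close>
    define \<delta> where "\<delta> = min \<delta>0 (1 - x)"
    have \<delta>: "\<delta> > 0" using \<delta>0 x by (simp add: \<delta>_def)
    have "0 < S" using S(1) by simp
    obtain L where L: "\<And>l j c w v. L \<le> l \<Longrightarrow> 1 \<le> j \<Longrightarrow>
        (\<forall>i\<in>{(j - 1) * l + 1..j * l}. \<bar>w i\<bar> \<le> S \<and> \<bar>(w i)\<^sup>2 - v\<bar> \<le> \<epsilon>) \<Longrightarrow>
        expectation (\<lambda>\<omega>. \<bar>local_var l (\<lambda>i \<omega>. c + w i * Y i \<omega>) j \<omega> - v\<bar>) \<le> 2 * \<epsilon>"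
      using local_var_LLN[OF meas stat mixing int2 E1 E2 \<open>0 < S\<close> \<epsilon>] by blast
    have ev_l: "\<forall>\<^sub>F n in sequentially. L \<le> ?l n"
      using powr_floor_at_top[of s] s by (simp add: filterlim_at_top block_length_def)
    have ev_b: "\<forall>\<^sub>F n in sequentially. nat \<lceil>1 / \<delta>\<rceil> + 1 \<le> ?b n"
      using powr_floor_at_top[of "1 - s"] s by (simp add: filterlim_at_top num_blocks_def)
    have "\<forall>\<^sub>F n in sequentially. norm (d n x - 0) < r"
      using ev_l ev_b
    proof eventually_elim
      case (elim n)
      show ?case
      proof (cases "n \<in> ?A")
        case n: True
        note blk = admissible_blocks[OF n]
        define j where "j = block_index (?b n) x"
        have j: "j \<in> {1..?b n}" "1 \<le> j"
          using block_index_range[OF blk(3), of x] x by (auto simp: j_def)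
        have jx: "(real j - 1) / real (?b n) \<le> x" "x < real j / real (?b n)"
          using block_index_eq_iff[OF blk(3), of x j] x j(2) by (auto simp: j_def)
        have "1 / \<delta> < real (?b n)" using elim(2) by linarith
        then have b\<delta>: "1 / real (?b n) < \<delta>" using \<delta> blk(3) by (simp add: field_simps)
        \<comment> \<open>The sampling points of block j and x itself lie in the closed interval
          [(j-1)/b, j/b] of length 1/b < \<delta>. Its right end is attained at i = j l.\<close>
        have close: "\<bar>real i / real n - x\<bar> < \<delta>" "0 \<le> real i / real n" "real i / real n < 1"
          if i: "i \<in> {(j - 1) * ?l n + 1..j * ?l n}" for i
        proof -
          have n_eq: "real n = real (?l n) * real (?b n)"
            using blk(1) by (metis of_nat_mult)
          have "real i \<le> real (j * ?l n)" using i by (intro of_nat_mono) simp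
          then have "real i / real n \<le> (real j * real (?l n)) / real n"
            by (intro divide_right_mono) simp_all
          also have "\<dots> = real j / real (?b n)"
            unfolding n_eq using blk(2,3) by simp
          finally have up: "real i / real n \<le> real j / real (?b n)" .
          have "real ((j - 1) * ?l n) \<le> real i" using i by (intro of_nat_mono) simp
          then have "((real j - 1) * real (?l n)) / real n \<le> real i / real n"
            using j(2) by (intro divide_right_mono) (simp_all add: of_nat_diff)
          then have lo: "(real j - 1) / real (?b n) \<le> real i / real n"
            unfolding n_eq using blk(2,3) by simp
          have width: "real j / real (?b n) = (real j - 1) / real (?b n) + 1 / real (?b n)"
            by (simp add: diff_divide_distrib)
          show c: "\<bar>real i / real n - x\<bar> < \<delta>"
            using up lo jx width b\<delta> by linarith
          show "0 \<le> real i / real n" by simp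
          have "\<delta> \<le> 1 - x" by (simp add: \<delta>_def)
          with c show "real i / real n < 1" by linarith
        qed
        have "f n \<omega> x = \<bar>local_var (?l n) (\<lambda>i \<omega>. \<mu>H + \<sigma> (real i / real n) * Y i \<omega>) j \<omega> - (\<sigma> x)\<^sup>2\<bar>" for \<omega>
        proof -
          have "local_var (?l n) (?X n) j \<omega> = local_var (?l n) (\<lambda>i \<omega>. \<mu>H + \<sigma> (real i / real n) * Y i \<omega>) j \<omega>"
            by (rule local_var_cong) (use \<mu> close in \<open>auto simp: obs_def\<close>)
          then show ?thesis using \<tau>(1)[of x] x by (simp add: f_def j_def)
        qed
        moreover have "expectation (\<lambda>\<omega>. \<bar>local_var (?l n) (\<lambda>i \<omega>. \<mu>H + \<sigma> (real i / real n) * Y i \<omega>) j \<omega> - (\<sigma> x)\<^sup>2\<bar>) \<le> 2 * \<epsilon>"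
        proof (rule L[OF elim(1) j(2)], intro ballI conjI)
          fix i assume i: "i \<in> {(j - 1) * ?l n + 1..j * ?l n}"
          show "\<bar>\<sigma> (real i / real n)\<bar> \<le> S" using close(2,3)[OF i] by (intro S(2)) auto
          show "\<bar>(\<sigma> (real i / real n))\<^sup>2 - (\<sigma> x)\<^sup>2\<bar> \<le> \<epsilon>"
            using close(1)[OF i] by (intro less_imp_le \<delta>0(2)) (simp add: \<delta>_def)
        qed
        ultimately have "d n x \<le> 2 * \<epsilon>" using n by (simp add: d_def)
        then show ?thesis using d_nonneg[of n x] \<open>0 < r\<close> by (simp add: \<epsilon>_def)
      qed (use \<open>0 < r\<close> in \<open>simp add: d_def\<close>)
    qed
    then show "\<exists>N. \<forall>n\<ge>N. norm (d n x - 0) < r" by (simp add: eventually_sequentially)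
  qed
  have AE_J: "AE x in unif01. x \<in> {0<..<1} - J"
  proof -
    have "AE x in lborel. x \<notin> insert 0 J"
      using J(1) by (intro AE_not_in) (auto intro!: finite_imp_null_set_lborel)
    then have "AE x in unif01. x \<notin> insert 0 J"
      by (subst AE_density) (auto elim: AE_mp)
    with AE_unif01 show ?thesis by eventually_elim auto
  qed
  have "(\<lambda>n. \<integral>x. d n x \<partial>unif01) \<longlonglongrightarrow> (\<integral>x. 0 \<partial>unif01)"
  proof (rule integral_dominated_convergence[where w = "\<lambda>_. K"])
    show "AE x in unif01. (\<lambda>n. d n x) \<longlonglongrightarrow> 0"
      using AE_J by eventually_elim (rule pointwise)
    have "0 \<le> K" by (simp add: K_def)
    then have "norm (d n x) \<le> K" if "x \<in> {0..<1}" for n x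
      using d_bound[of n x] d_nonneg[of n x] that by (cases "n \<in> ?A") (auto simp: d_def)
    then show "AE x in unif01. norm (d n x) \<le> K" for n
      using AE_unif01 by auto
  qed auto
  then show "(\<lambda>n. if n \<in> ?A then expectation (\<lambda>\<omega>. \<integral>x. f n \<omega> x \<partial>unif01) else 0) \<longlonglongrightarrow> 0"
    unfolding E_eq by simp
qed

section \<open>Combination of the estimates\<close>

theorem proposition2p10:
  fixes M :: "'a measure" and Y :: "nat \<Rightarrow> 'a \<Rightarrow> real"
    and P :: "'b measure" and Z Z' :: "'b \<Rightarrow> real" and G :: "real \<Rightarrow> real \<Rightarrow> 'b \<Rightarrow> real"
    and \<mu> \<sigma> :: "real \<Rightarrow> real" and \<sigma>0 \<mu>H s \<delta> \<rho> C :: real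
  assumes "prob_space M"
    and "\<And>i. 1 \<le> i \<Longrightarrow> Y i \<in> borel_measurable M"
    and "strictly_stationary M Y"
    and "prob_space.expectation M (Y 1) = 0"
    and "prob_space.variance M (Y 1) = 1"
    and "alpha_mixing M Y"
    and "long_run_variance M Y > 0"
    and "cadlag01 \<mu>"
    and "cadlag01 \<sigma>"
    and "piecewise_lipschitz01 \<sigma>"
    and "\<sigma>0 > 0"
    and "\<And>x. x \<in> {0..1} \<Longrightarrow> \<sigma> x \<ge> \<sigma>0"
    and "1 / 2 < s" and "s < 1"
    and "prob_space P"
    and "distributed P lborel Z std_normal_density"
    and "distributed P lborel Z' std_normal_density"
    and "prob_space.indep_var P borel Z borel Z'"
    and "cond_abs_version P Z Z' G"
    and "0 < \<delta>" and "\<delta> \<le> 1" and "\<rho> > 1"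
    and "integrable M (\<lambda>\<omega>. \<bar>Y 1 \<omega>\<bar> powr (2 + \<delta>))"
    and "\<And>k. 1 \<le> k \<Longrightarrow>
           alpha_mixing_coeff M Y k \<le> C * real k powr (- (\<rho> * (2 + \<delta>) * (1 + \<delta>) / \<delta>\<^sup>2))"
    and "\<rho> > \<delta> * (8 + \<delta>) / ((2 + \<delta>) * (1 + \<delta>)) \<or>
         integrable M (\<lambda>\<omega>. \<bar>Y 1 \<omega>\<bar> powr (4 + 2 * \<delta>))"
    and "AE x in lborel. x \<in> {0..1} \<longrightarrow> \<mu> x = \<mu>H"
  shows "(\<forall>n\<in>admissible s. integrable M (psi_hat_sq P Z Z' s \<mu> \<sigma> Y n)) \<and>
         ((\<lambda>n. prob_space.expectation M
                 (\<lambda>\<omega>. \<bar>psi_hat_sq P Z Z' s \<mu> \<sigma> Y n \<omega> - psi_sq P Z Z' G \<sigma>\<bar>))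
            \<longlongrightarrow> 0) (inf sequentially (principal (admissible s)))"
proof -
  interpret prob_space M by fact
  note meas = assms(2) and P = assms(15-18)
  let ?A = "admissible s" and ?N = std_normal_distribution
  let ?psi = "psi_hat_sq P Z Z' s \<mu> \<sigma> Y" and ?q = "psi_sq P Z Z' G \<sigma>"
  \<comment> \<open>A non-integrable function has integral 0, so a second moment equal to 1 already
    implies integrability; the mean 0 turns the variance into that second moment.\<close>
  have int2: "integrable M (\<lambda>\<omega>. (Y 1 \<omega>)\<^sup>2)" and E2: "expectation (\<lambda>\<omega>. (Y 1 \<omega>)\<^sup>2) = 1"
    using assms(4,5) not_integrable_integral_eq[of M "\<lambda>\<omega>. (Y 1 \<omega>)\<^sup>2"] by auto
  obtain S where S: "1 \<le> S" "\<And>x. x \<in> {0..1} \<Longrightarrow> \<bar>\<sigma> x\<bar> \<le> S"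
    using piecewise_lipschitz01_bounded[OF assms(10)] by blast
  obtain J where J: "finite J" "\<And>x. x \<in> {0<..<1} - J \<Longrightarrow> isCont \<sigma> x"
    using piecewise_lipschitz01_isCont[OF assms(10)] by blast
  \<comment> \<open>\<sigma> is arbitrary outside [0,1]; the cut-off is Borel, nonnegative and
    bounded on the whole line.\<close>
  define \<tau> where "\<tau> = (\<lambda>x. indicator {0..1} x * \<sigma> x)"
  have \<tau>_meas [measurable]: "\<tau> \<in> borel_measurable borel"
    unfolding \<tau>_def by (rule piecewise_lipschitz01_measurable) fact
  have \<tau>: "\<tau> x = \<sigma> x" if "x \<in> {0..1}" for x using that by (simp add: \<tau>_def)
  have \<tau>_bound: "\<bar>\<tau> x\<bar> \<le> S" for x using S by (auto simp: \<tau>_def indicator_def)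
  have \<tau>0: "0 \<le> \<tau> x" for x
    using assms(11) assms(12)[of x] by (auto simp: \<tau>_def indicator_def)
  define W where "W = (\<lambda>n \<omega>. \<integral>x. \<bar>local_var (block_length s n) (obs \<mu> \<sigma> Y n)
      (block_index (num_blocks s n) x) \<omega> - (\<tau> x)\<^sup>2\<bar> \<partial>unif01)"
  have \<mu>: "\<mu> x = \<mu>H" if "x \<in> {0..<1}" for x
    by (rule cadlag01_AE_constant[OF assms(8,26) that])
  have s: "0 < s" "s < 1" using assms(13,14) by auto
  note bv = blockwise_variance_tendsto[OF meas assms(3,6) int2 assms(4) E2 \<mu> J S s \<tau>_meas \<tau> \<tau>_bound]
  have f_int: "integrable unif01 (\<lambda>x. \<bar>local_var (block_length s n) (obs \<mu> \<sigma> Y n)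
      (block_index (num_blocks s n) x) \<omega> - (\<tau> x)\<^sup>2\<bar>)" if "n \<in> ?A" for n \<omega>
    using that by (intro bv(1))
  have W_int: "integrable M (W n)" if "n \<in> ?A" for n
    using that unfolding W_def by (intro bv(2))
  define w where "w = (\<lambda>n. if n \<in> ?A then expectation (W n) else 0)"
  have w_lim: "w \<longlonglongrightarrow> 0"
    unfolding w_def W_def by (intro bv(3))
  have W0: "0 \<le> W n \<omega>" for n \<omega> unfolding W_def by simp
  \<comment> \<open>The stability bound contains sqrt D, so W enters through its square root as
    well; Jensen reduces this to E W.\<close>
  have sqrt_W: "integrable M (\<lambda>\<omega>. sqrt (W n \<omega>))" "expectation (\<lambda>\<omega>. sqrt (W n \<omega>)) \<le> sqrt (w n)"
    if n: "n \<in> ?A" for n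
  proof -
    have "(\<lambda>\<omega>. sqrt (W n \<omega>)) \<in> borel_measurable M"
      using borel_measurable_integrable[OF W_int[OF n]] by measurable
    from expectation_abs_le_sqrt[OF this]
    show "integrable M (\<lambda>\<omega>. sqrt (W n \<omega>))" "expectation (\<lambda>\<omega>. sqrt (W n \<omega>)) \<le> sqrt (w n)"
      using W_int[OF n] W0 n by (simp_all add: w_def)
  qed
  define u where "u = (\<lambda>n \<omega> j. local_sd (block_length s n) (obs \<mu> \<sigma> Y n) j \<omega>)"
  define \<rho>' where "\<rho>' = (\<integral>z. (2 * (\<bar>z\<bar> + 1))\<^sup>2 \<partial>?N)"
  have \<rho>': "0 \<le> \<rho>'" unfolding \<rho>'_def by simp
  define e where "e = (\<lambda>n. S / (real (num_blocks s n) - 1))"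
  \<comment> \<open>W and its square root are separate arguments because \<open>R\<close> is affine
    in both: expectations pass through, and E (sqrt W) is replaced by sqrt (E W) by
    monotonicity.\<close>
  define R where "R = (\<lambda>n t r. 4 * \<rho>' * (96 * t + 48 * (e n)\<^sup>2 + 16 * S * (2 * r + e n)))"
  have psi_eq: "?psi n \<omega> = 4 * (1 / real (num_blocks s n) * (\<Sum>j = 1..num_blocks s n. \<integral>z.
      (1 / (real (num_blocks s n) - 1) * (\<Sum>k\<in>{1..num_blocks s n} - {j}.
        gauss_abs_centred (u n \<omega> j) (u n \<omega> k) z))\<^sup>2 \<partial>?N))" for n \<omega>
    unfolding psi_hat_sq_def f_fun_eq[OF P] u_def ..
  have q_eq: "?q = 4 * (\<integral>x. \<integral>z. (\<integral>y. gauss_abs_centred (\<tau> x) (\<tau> y) z \<partial>unif01)\<^sup>2 \<partial>?N \<partial>unif01)"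
    by (rule psi_sq_eq_unif01[OF P assms(19) \<tau>_meas]) (simp add: \<tau>)
  have bound: "\<bar>?psi n \<omega> - ?q\<bar> \<le> R n (W n \<omega>) (sqrt (W n \<omega>))"
    if n: "n \<in> ?A" and b: "2 \<le> num_blocks s n" for n \<omega>
  proof -
    define D where "D = (\<integral>x. (u n \<omega> (block_index (num_blocks s n) x) - \<tau> x)\<^sup>2 \<partial>unif01)"
    have D_le: "D \<le> W n \<omega>"
      unfolding D_def W_def
    proof (rule unif01.expectation_dominated(2)[OF _ f_int[OF n]])
      have "(\<lambda>x. u n \<omega> (block_index (num_blocks s n) x)) \<in> borel_measurable borel"
        by measurable
      then show "(\<lambda>x. (u n \<omega> (block_index (num_blocks s n) x) - \<tau> x)\<^sup>2) \<in> borel_measurable unif01"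
        by simp
      show "\<bar>(u n \<omega> (block_index (num_blocks s n) x) - \<tau> x)\<^sup>2\<bar>
          \<le> \<bar>local_var (block_length s n) (obs \<mu> \<sigma> Y n) (block_index (num_blocks s n) x) \<omega> - (\<tau> x)\<^sup>2\<bar>" for x
        unfolding u_def local_sd_def using sqrt_diff_square_le[OF local_var_nonneg \<tau>0] by simp
    qed
    have "\<bar>?psi n \<omega> - ?q\<bar> \<le> 4 * (\<rho>' * (96 * D + 48 * (e n)\<^sup>2 + 16 * S * (2 * sqrt D + e n)))"
      using gauss_functional_diff[OF b \<tau>_meas \<tau>_bound, of "u n \<omega>"]
      unfolding psi_eq q_eq right_diff_distrib[symmetric] abs_mult D_def \<rho>'_def e_def by simp
    also have "\<dots> \<le> 4 * (\<rho>' * (96 * W n \<omega> + 48 * (e n)\<^sup>2 + 16 * S * (2 * sqrt (W n \<omega>) + e n)))"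
      using D_le \<rho>' S(1) by (intro mult_left_mono add_mono) auto
    finally show ?thesis by (simp add: R_def)
  qed
  have R_int: "integrable M (\<lambda>\<omega>. R n (W n \<omega>) (sqrt (W n \<omega>)))" if "n \<in> ?A" for n
    unfolding R_def using W_int[OF that] sqrt_W(1)[OF that] by simp
  have psi_meas: "?psi n \<in> borel_measurable M" for n
  proof -
    have X_meas: "(\<lambda>\<omega>. obs \<mu> \<sigma> Y n i \<omega>) \<in> borel_measurable M" if "1 \<le> i" for i
      using meas[OF that] unfolding obs_def by measurable
    have u_meas: "(\<lambda>\<omega>. u n \<omega> j) \<in> borel_measurable M" for j
      unfolding u_def local_sd_def
      using local_var_measurable[of "obs \<mu> \<sigma> Y n" M] X_meas by measurable
    have [measurable]: "(\<lambda>p. u n (fst p) j) \<in> borel_measurable (M \<Otimes>\<^sub>M ?N)" for j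
      by (rule measurable_compose[OF measurable_fst u_meas])
    have "(\<lambda>\<omega>. \<integral>z. (1 / (real (num_blocks s n) - 1) * (\<Sum>k\<in>{1..num_blocks s n} - {j}.
        gauss_abs_centred (u n \<omega> j) (u n \<omega> k) z))\<^sup>2 \<partial>?N) \<in> borel_measurable M" for j
      by (rule std_normal.borel_measurable_lebesgue_integral) (unfold case_prod_beta, measurable)
    then have "(\<lambda>\<omega>. ?psi n \<omega>) \<in> borel_measurable M"
      unfolding psi_eq by measurable
    then show ?thesis .
  qed
  have psi_int: "integrable M (?psi n)" if n: "n \<in> ?A" for n
  proof (cases "2 \<le> num_blocks s n")
    case True
    have "integrable M (\<lambda>\<omega>. ?psi n \<omega> - ?q)"
      by (rule expectation_dominated(1)[OF _ R_int[OF n] bound[OF n True]])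
         (use psi_meas[of n] in measurable)
    from Bochner_Integration.integrable_add[OF this integrable_const[of ?q]]
    show ?thesis by simp
  next
    case False
    \<comment> \<open>With a single block the inner sum is empty, so the estimator is 0 and
      integrability holds here too.\<close>
    then have "num_blocks s n = 1" using admissible_blocks(3)[OF n] by simp
    then have "?psi n = (\<lambda>\<omega>. 0)" unfolding psi_eq by (intro ext) simp
    then show ?thesis by simp
  qed
  have b_lim: "filterlim (num_blocks s) at_top sequentially"
    using powr_floor_at_top[of "1 - s"] s by (simp add: num_blocks_def[abs_def])
  have e_lim: "e \<longlonglongrightarrow> 0"
  proof -
    have "filterlim (\<lambda>n. real (num_blocks s n)) at_top sequentially"
      by (rule filterlim_compose[OF filterlim_real_sequentially b_lim])
    then have "filterlim (\<lambda>n. - 1 + real (num_blocks s n)) at_top sequentially"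
      by (intro filterlim_tendsto_add_at_top[OF tendsto_const])
    then have "filterlim (\<lambda>n. real (num_blocks s n) - 1) at_infinity sequentially"
      by (intro filterlim_at_top_imp_at_infinity) simp
    then show ?thesis unfolding e_def by (intro tendsto_divide_0[OF tendsto_const])
  qed
  have "(\<lambda>n. R n (w n) (sqrt (w n))) \<longlonglongrightarrow> 4 * \<rho>' * (96 * 0 + 48 * 0\<^sup>2 + 16 * S * (2 * sqrt 0 + 0))"
    unfolding R_def by (intro tendsto_intros w_lim e_lim)
  then have R_lim: "((\<lambda>n. R n (w n) (sqrt (w n))) \<longlongrightarrow> 0) (inf sequentially (principal ?A))"
    by (intro tendsto_mono[OF inf_le1]) simp
  have "\<forall>\<^sub>F n in sequentially. 2 \<le> num_blocks s n"
    using b_lim by (simp add: filterlim_at_top)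
  then have "\<forall>\<^sub>F n in inf sequentially (principal ?A). expectation (\<lambda>\<omega>. \<bar>?psi n \<omega> - ?q\<bar>) \<le> R n (w n) (sqrt (w n))"
    unfolding eventually_inf_principal
  proof eventually_elim
    case (elim n)
    show ?case
    proof
      assume n: "n \<in> ?A"
      have "expectation (\<lambda>\<omega>. \<bar>?psi n \<omega> - ?q\<bar>) \<le> expectation (\<lambda>\<omega>. R n (W n \<omega>) (sqrt (W n \<omega>)))"
        using psi_int[OF n] R_int[OF n] bound[OF n elim] by (intro integral_mono) auto
      also have "\<dots> = R n (w n) (expectation (\<lambda>\<omega>. sqrt (W n \<omega>)))"
        unfolding R_def using W_int[OF n] sqrt_W(1)[OF n] n by (simp add: prob_space w_def)
      also have "\<dots> \<le> R n (w n) (sqrt (w n))"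
        unfolding R_def using \<rho>' S(1) sqrt_W(2)[OF n] by (intro mult_left_mono add_mono) auto
      finally show "expectation (\<lambda>\<omega>. \<bar>?psi n \<omega> - ?q\<bar>) \<le> R n (w n) (sqrt (w n))" .
    qed
  qed
  then have "((\<lambda>n. expectation (\<lambda>\<omega>. \<bar>?psi n \<omega> - ?q\<bar>)) \<longlongrightarrow> 0) (inf sequentially (principal ?A))"
    by (intro tendsto_sandwich[OF _ _ tendsto_const R_lim]) auto
  with psi_int show ?thesis by blast
qed

end
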